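(* For every integer $n\ge 4$, the polynomial $K_n$ is an irreducible element of the ring $\overline{\mathbb{Z}}[x_{ij} : 1\le i<j\le n]$.
   Context: For a positive integer $n$ let $\{x_{ij} : 1\le i<j\le n\}$ be a set of $(n-1)n/2$ independent variables. $X_n$ denotes the general symmetric $n\times n$ matrix with zeros on the diagonal: its diagonal entries are $0$ and its $(i,j)$ and $(j,i)$ entries are both $x_{ij}$ for $1\le i<j\le n$. Set $K_n:=\det(X_n)$ if $n$ is even and $K_n:=\det(X_n)/2$ if $n$ is odd; for odd $n$ all coefficients of $\det(X_n)$ are even, so $K_n\in\mathbb{Z}[x_{ij}:1\le i<j\le n]$ in all cases. $\overline{\mathbb{Z}}$ denotes the ring of all algebraic integers, i.e. the elements of an algebraic closure $\overline{\mathbb{Q}}$ of $\mathbb{Q}$ that are roots of a monic polynomial with integer coefficients. *)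

theory Defs
  imports
    "HOL-Library.Poly_Mapping"
    "HOL-Computational_Algebra.Polynomial"
    "HOL-Algebra.Ring_Divisibility"
    "Jordan_Normal_Form.Determinant"
begin

(* Polynomials with complex coefficients in variables x_(i,j) indexed by pairs of naturals:
   a finitely supported map from monomials (finitely supported exponent maps) to coefficients,
   with the convolution product of HOL-Library.Poly_Mapping. *)
type_synonym cpolynomial = "((nat \<times> nat) \<Rightarrow>\<^sub>0 nat) \<Rightarrow>\<^sub>0 complex"

definition Const :: "complex \<Rightarrow> cpolynomial" where
  "Const c = Poly_Mapping.single 0 c"

definition Var :: "nat \<times> nat \<Rightarrow> cpolynomial" where
  "Var v = Poly_Mapping.single (Poly_Mapping.single v 1) 1"

definition var_indices :: "nat \<Rightarrow> (nat \<times> nat) set" where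
  "var_indices n = {(i, j). 1 \<le> i \<and> i < j \<and> j \<le> n}"

(* The algebraic integers are taken inside the complex numbers, which contain an algebraic
   closure of the rationals; algebraic_int x says that x is a root of a monic polynomial
   with integer coefficients. *)
definition alg_int_poly_ring :: "nat \<Rightarrow> cpolynomial ring" where
  "alg_int_poly_ring n =
     \<lparr> carrier = {p. (\<forall>m. algebraic_int (Poly_Mapping.lookup p m)) \<and>
                      (\<forall>m \<in> Poly_Mapping.keys p. Poly_Mapping.keys m \<subseteq> var_indices n)},
       mult = (*), one = 1, zero = 0, add = (+) \<rparr>"

(* Matrix positions in Jordan_Normal_Form start at 0, the variables' indices at 1. *)
definition X :: "nat \<Rightarrow> cpolynomial mat" where
  "X n = mat n n (\<lambda>(i, j).
     if i = j then 0 else if i < j then Var (i + 1, j + 1) else Var (j + 1, i + 1))"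

definition K :: "nat \<Rightarrow> cpolynomial" where
  "K n = (if even n then det (X n) else Const (1 / 2) * det (X n))"

end

theory Submission
  imports Defs "HOL-Library.Product_Lexorder"
begin

text \<open>
  By the Leibniz formula, a monomial of \<open>det X\<^sub>n\<close> comes from a derangement \<open>\<sigma>\<close>: it is the product of
  the edges \<open>{i, \<sigma> i}\<close> of the complete graph on \<open>n\<close> vertices, so every vertex has degree 2 in it, and
  its coefficient is the signed number of derangements with the same edges (\<open>lookup_det_X\<close>). For odd
  \<open>n\<close> inversion pairs off these derangements, whence the coefficients are even (\<open>even_det_coeff\<close>). On
  the other hand, a perfect matching taken twice, completed by a triangle if \<open>n\<close> is odd, has
  coefficient \<open>\<plusminus>1\<close> or \<open>\<plusminus>2\<close> (\<open>det_coeff_primitive\<close>). Thus \<open>K\<^sub>n\<close> is integral with a coefficient \<open>\<plusminus>1\<close>,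
  a constant factor of it is a unit, and it suffices to exclude nonconstant factors over the complex
  numbers.

  Let \<open>K\<^sub>n = A B\<close>. The degree in row \<open>i\<close> is an additive weight for which \<open>K\<^sub>n\<close> is homogeneous, so \<open>A\<close> and
  \<open>B\<close> are homogeneous too (\<open>factors_homogeneous\<close>), of degrees \<open>a\<^sub>i + b\<^sub>i = 2\<close>. For \<open>i \<noteq> j\<close>, some monomial
  of \<open>K\<^sub>n\<close> meets the rows \<open>i\<close> and \<open>j\<close> only in the square of \<open>x\<^sub>i\<^sub>j\<close>; a monomial of \<open>A\<close> dividing it has the
  same degree in both rows, which gives \<open>a\<^sub>i = a\<^sub>j\<close> (\<open>row_degree_eq\<close>). If the common value is 0 or 2,
  one factor is constant.

  It remains to rule out the value 1, where every monomial of \<open>A\<close> and \<open>B\<close> is a perfect matching. For odd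
  \<open>n\<close> the monomial of \<open>K\<^sub>n\<close> made of a triangle and a doubled matching cannot be split in this way
  (\<open>no_linear_factor_odd\<close>). For even \<open>n\<close>, fix a perfect matching \<open>r\<close> outside four vertices and complete
  it by the three pairings \<open>M\<^sub>1, M\<^sub>2, M\<^sub>3\<close> of these vertices. With \<open>\<alpha>\<^sub>i, \<beta>\<^sub>i\<close> the coefficients of \<open>M\<^sub>i r\<close> in
  \<open>A\<close> and \<open>B\<close>, comparing the coefficients of \<open>M\<^sub>i M\<^sub>j r\<^sup>2\<close> gives \<open>\<alpha>\<^sub>i \<beta>\<^sub>i = c\<close> and
  \<open>\<alpha>\<^sub>i \<beta>\<^sub>j + \<alpha>\<^sub>j \<beta>\<^sub>i = -2 c\<close> with the same \<open>c = \<plusminus>1\<close>. Hence \<open>\<alpha>\<^sub>i = - \<alpha>\<^sub>j\<close> for all \<open>i \<noteq> j\<close>, which is impossible for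
  three nonzero numbers (\<open>no_linear_factor_even\<close>).
\<close>

section \<open>The coefficients of the determinant\<close>

text \<open>Matrix positions start at 0 and variable indices at 1, hence the shift; sorting the two ends makes
  the two symmetric entries of the matrix the same variable.\<close>

definition edge :: "nat \<Rightarrow> nat \<Rightarrow> nat \<times> nat" where
  "edge i j = (min i j + 1, max i j + 1)"

lemma edge_commute: "edge i j = edge j i"
  by (simp add: edge_def min.commute max.commute)

lemma edge_eq_iff: "edge a b = edge c d \<longleftrightarrow> (a = c \<and> b = d) \<or> (a = d \<and> b = c)"
  by (auto simp: edge_def min_def max_def split: if_splits)

definition edges_on :: "nat set \<Rightarrow> (nat \<times> nat) set" where
  "edges_on S = {edge i j | i j. i \<in> S \<and> j \<in> S \<and> i \<noteq> j}"

lemma edge_in_edges_on: "edge i j \<in> edges_on S \<longleftrightarrow> i \<in> S \<and> j \<in> S \<and> i \<noteq> j"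
  by (auto simp: edges_on_def edge_eq_iff)

lemma edges_on_lessThan: "edges_on {..<n} = var_indices n"
proof (intro equalityI subsetI)
  fix e assume "e \<in> edges_on {..<n}"
  then show "e \<in> var_indices n"
    by (auto simp: edges_on_def edge_def var_indices_def min_def max_def)
next
  fix e assume e: "e \<in> var_indices n"
  obtain a b where ab: "e = (a, b)" by fastforce
  with e have "e = edge (a - 1) (b - 1)" "a - 1 < n" "b - 1 < n" "a - 1 \<noteq> b - 1"
    by (auto simp: var_indices_def edge_def min_def max_def)
  then show "e \<in> edges_on {..<n}" by (auto simp: edges_on_def)
qed

text \<open>A permutation with a fixed point meets the zero diagonal and contributes nothing to the determinant.\<close>

definition derangements :: "nat set \<Rightarrow> (nat \<Rightarrow> nat) set" where
  "derangements S = {\<sigma>. \<sigma> permutes S \<and> (\<forall>i\<in>S. \<sigma> i \<noteq> i)}"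

lemma derangementsD: "\<sigma> \<in> derangements S \<Longrightarrow> \<sigma> permutes S"
  "\<sigma> \<in> derangements S \<Longrightarrow> i \<in> S \<Longrightarrow> \<sigma> i \<noteq> i"
  "\<sigma> \<in> derangements S \<Longrightarrow> i \<in> S \<Longrightarrow> i \<noteq> \<sigma> i"
  "\<sigma> \<in> derangements S \<Longrightarrow> i \<in> S \<Longrightarrow> \<sigma> i \<in> S"
  by (force simp: derangements_def permutes_in_image)+

lemma finite_derangements: "finite S \<Longrightarrow> finite (derangements S)"
  by (simp add: derangements_def finite_permutations)

definition cycle_monom :: "nat set \<Rightarrow> (nat \<Rightarrow> nat) \<Rightarrow> (nat \<times> nat) \<Rightarrow>\<^sub>0 nat" where
  "cycle_monom S \<sigma> = (\<Sum>i\<in>S. Poly_Mapping.single (edge i (\<sigma> i)) 1)"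

text \<open>The coefficient of \<open>m\<close> in the principal minor with row set \<open>S\<close>. Arbitrary finite row sets make it
  possible to delete rows one pair at a time.\<close>

definition det_coeff :: "nat set \<Rightarrow> ((nat \<times> nat) \<Rightarrow>\<^sub>0 nat) \<Rightarrow> int" where
  "det_coeff S m = (\<Sum>\<sigma> | \<sigma> \<in> derangements S \<and> cycle_monom S \<sigma> = m. sign \<sigma>)"

lemma prod_single_monom:
  "(\<Prod>i\<in>S. Poly_Mapping.single (f i) (1::'a::comm_semiring_1)) =
     Poly_Mapping.single (\<Sum>i\<in>S. f i :: 'b::comm_monoid_add) 1"
  by (induction S rule: infinite_finite_induct) (simp_all add: mult_single)

lemma X_index:
  "i < n \<Longrightarrow> j < n \<Longrightarrow>
     X n $$ (i, j) = (if i = j then 0 else Poly_Mapping.single (Poly_Mapping.single (edge i j) 1) 1)"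
  by (auto simp: X_def Var_def edge_def min_def max_def)

lemma lookup_det_X: "Poly_Mapping.lookup (det (X n)) m = of_int (det_coeff {..<n} m)"
proof -
  let ?P = "{\<sigma>. \<sigma> permutes {..<n}}"
  have fin: "finite ?P" by (simp add: finite_permutations)
  have prd: "(\<Prod>i = 0..<n. X n $$ (i, \<sigma> i)) =
      (if \<sigma> \<in> derangements {..<n} then Poly_Mapping.single (cycle_monom {..<n} \<sigma>) 1 else 0)"
    if p: "\<sigma> permutes {..<n}" for \<sigma>
  proof (cases "\<sigma> \<in> derangements {..<n}")
    case True
    have "(\<Prod>i = 0..<n. X n $$ (i, \<sigma> i)) =
        (\<Prod>i\<in>{..<n}. Poly_Mapping.single (Poly_Mapping.single (edge i (\<sigma> i)) 1) 1)"
      unfolding atLeast0LessThan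
    proof (intro prod.cong refl)
      fix i assume "i \<in> {..<n}"
      then show "X n $$ (i, \<sigma> i) = Poly_Mapping.single (Poly_Mapping.single (edge i (\<sigma> i)) 1) 1"
        using derangementsD(3,4)[OF True] by (subst X_index) auto
    qed
    then show ?thesis using True by (simp add: prod_single_monom cycle_monom_def)
  next
    case False
    then obtain i where "i < n" "\<sigma> i = i" using p by (auto simp: derangements_def)
    then have "(\<Prod>i = 0..<n. X n $$ (i, \<sigma> i)) = 0"
      by (intro prod_zero) (auto intro!: bexI[of _ i] simp: X_index)
    then show ?thesis using False by simp
  qed
  have "det (X n) = (\<Sum>\<sigma>\<in>?P. of_int (sign \<sigma>) * (\<Prod>i = 0..<n. X n $$ (i, \<sigma> i)))"
    by (subst det_def'[of _ n]) (simp_all add: X_def atLeast0LessThan)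
  also have "\<dots> = (\<Sum>\<sigma>\<in>?P. if \<sigma> \<in> derangements {..<n}
      then of_int (sign \<sigma>) * Poly_Mapping.single (cycle_monom {..<n} \<sigma>) 1 else 0)"
    by (intro sum.cong refl) (simp add: prd)
  also have "\<dots> = (\<Sum>\<sigma>\<in>derangements {..<n}.
      of_int (sign \<sigma>) * Poly_Mapping.single (cycle_monom {..<n} \<sigma>) 1)"
    by (intro sum.mono_neutral_cong_right fin) (auto simp: derangements_def)
  finally have "Poly_Mapping.lookup (det (X n)) m = (\<Sum>\<sigma>\<in>derangements {..<n}.
      Poly_Mapping.lookup (of_int (sign \<sigma>) * Poly_Mapping.single (cycle_monom {..<n} \<sigma>) 1) m)"
    by (simp add: lookup_sum)
  also have "\<dots> = (\<Sum>\<sigma>\<in>derangements {..<n}. if cycle_monom {..<n} \<sigma> = m then of_int (sign \<sigma>) else 0)"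
    by (intro sum.cong refl) (auto simp: lookup_single sign_def when_def)
  also have "\<dots> = of_int (det_coeff {..<n} m)"
    by (simp add: det_coeff_def sum.If_cases finite_derangements Int_def of_int_sum)
  finally show ?thesis .
qed

lemma even_sum_involution:
  fixes h :: "'a \<Rightarrow> int"
  assumes "finite F" "\<And>x. x \<in> F \<Longrightarrow> f x \<in> F" "\<And>x. x \<in> F \<Longrightarrow> f (f x) = x"
    "\<And>x. x \<in> F \<Longrightarrow> f x \<noteq> x" "\<And>x. x \<in> F \<Longrightarrow> h (f x) = h x"
  shows "even (sum h F)"
  using assms
proof (induction "card F" arbitrary: F rule: less_induct)
  case less
  show ?case
  proof (cases "F = {}")
    case False
    then obtain x where x: "x \<in> F" by auto
    let ?G = "F - {x, f x}"
    have "even (sum h ?G)"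
    proof (rule less.hyps)
      show "card ?G < card F" using x less.prems(1) by (intro psubset_card_mono) auto
      show "f y \<in> ?G" if "y \<in> ?G" for y
        using that less.prems(2,3) x by (metis Diff_iff insert_iff singletonD)
    qed (use less.prems in auto)
    moreover have "sum h F = sum h ?G + (h x + h (f x))"
    proof -
      have "sum h F = sum h ?G + sum h {x, f x}"
        using x less.prems(1,2) by (intro sum.subset_diff) auto
      then show ?thesis using less.prems(4)[OF x] by auto
    qed
    ultimately show ?thesis using less.prems(5)[OF x] by simp
  qed simp
qed

lemma cycle_monom_inv:
  assumes "\<sigma> permutes S"
  shows "cycle_monom S (inv_into UNIV \<sigma>) = cycle_monom S \<sigma>"
proof -
  have "cycle_monom S (inv_into UNIV \<sigma>) = (\<Sum>i\<in>\<sigma> ` S. Poly_Mapping.single (edge i (inv_into UNIV \<sigma> i)) 1)"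
    using assms by (simp add: cycle_monom_def permutes_image)
  also have "\<dots> = (\<Sum>i\<in>S. Poly_Mapping.single (edge (\<sigma> i) (inv_into UNIV \<sigma> (\<sigma> i))) 1)"
    using permutes_inj_on[OF assms] by (subst sum.reindex) auto
  also have "\<dots> = cycle_monom S \<sigma>"
    using permutes_inverses(2)[OF assms] by (simp add: cycle_monom_def edge_commute)
  finally show ?thesis .
qed

lemma inv_derangement: "\<sigma> \<in> derangements S \<Longrightarrow> inv_into UNIV \<sigma> \<in> derangements S"
  by (auto simp: derangements_def permutes_inv) (metis permutes_inv_eq)

text \<open>Inversion keeps both the sign and the monomial, since reversing all edges changes nothing. It has no
  fixed point: a self-inverse derangement would split a set of odd size into pairs.\<close>

lemma even_det_coeff:
  assumes "finite S" "odd (card S)"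
  shows "even (det_coeff S m)"
  unfolding det_coeff_def
proof (rule even_sum_involution[where f = "inv_into UNIV"])
  fix \<sigma> assume s: "\<sigma> \<in> {\<sigma>. \<sigma> \<in> derangements S \<and> cycle_monom S \<sigma> = m}"
  then have p: "\<sigma> permutes S" by (auto dest: derangementsD)
  show "inv_into UNIV \<sigma> \<in> {\<sigma>. \<sigma> \<in> derangements S \<and> cycle_monom S \<sigma> = m}"
    using s p by (auto simp: inv_derangement cycle_monom_inv)
  show "inv_into UNIV (inv_into UNIV \<sigma>) = \<sigma>" using p by (simp add: permutes_inv_inv)
  show "sign (inv_into UNIV \<sigma>) = sign \<sigma>"
    using p assms(1) permutation_permutes sign_inverse by blast
  show "inv_into UNIV \<sigma> \<noteq> \<sigma>"
  proof
    assume i: "inv_into UNIV \<sigma> = \<sigma>"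
    have "even (sum (\<lambda>_. 1::int) S)"
    proof (rule even_sum_involution[where f = \<sigma>])
      show "\<sigma> (\<sigma> x) = x" for x using p i by (metis permutes_inverses(1))
    qed (use s assms in \<open>auto dest: derangementsD\<close>)
    then show False using assms(2) by simp
  qed
qed (use assms in \<open>simp add: finite_derangements\<close>)

section \<open>Factors of homogeneous polynomials\<close>

lemma poly_mapping_sum_single: "(\<Sum>a\<in>Poly_Mapping.keys p. Poly_Mapping.single a (Poly_Mapping.lookup p a)) = p"
  by (intro poly_mapping_eqI)
     (auto simp: lookup_sum lookup_single when_def in_keys_iff)

lemma lookup_mult_keys:
  fixes p q :: "'a::comm_monoid_add \<Rightarrow>\<^sub>0 'b::comm_semiring_1"
  shows "Poly_Mapping.lookup (p * q) m = (\<Sum>a\<in>Poly_Mapping.keys p. \<Sum>b\<in>Poly_Mapping.keys q.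
    if a + b = m then Poly_Mapping.lookup p a * Poly_Mapping.lookup q b else 0)"
proof -
  have "p * q = (\<Sum>a\<in>Poly_Mapping.keys p. Poly_Mapping.single a (Poly_Mapping.lookup p a)) *
      (\<Sum>b\<in>Poly_Mapping.keys q. Poly_Mapping.single b (Poly_Mapping.lookup q b))"
    by (simp add: poly_mapping_sum_single)
  then show ?thesis
    by (simp add: sum_product lookup_sum mult_single lookup_single when_def)
qed

text \<open>The extreme monomials of highest weight, ties being broken by the order on monomials, have a product
  that arises in only one way, so its coefficient is a product of two nonzero ones.\<close>

lemma extremal_keys:
  fixes p q :: "'a::{ordered_cancel_comm_monoid_add, linorder} \<Rightarrow>\<^sub>0 'b::idom" and w :: "'a \<Rightarrow> int"
  assumes "p \<noteq> 0" "q \<noteq> 0" and w: "\<And>a b. w (a + b) = w a + w b"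
  obtains a b where "a \<in> Poly_Mapping.keys p" "b \<in> Poly_Mapping.keys q" "a + b \<in> Poly_Mapping.keys (p * q)"
    "\<And>a'. a' \<in> Poly_Mapping.keys p \<Longrightarrow> w a' \<le> w a"
    "\<And>b'. b' \<in> Poly_Mapping.keys q \<Longrightarrow> w b' \<le> w b"
proof -
  have top: "\<exists>a\<in>Poly_Mapping.keys r. \<forall>a'\<in>Poly_Mapping.keys r. w a' \<le> w a \<and> (w a' = w a \<longrightarrow> a' \<le> a)"
    if "r \<noteq> 0" for r :: "'a \<Rightarrow>\<^sub>0 'b"
  proof -
    let ?k = "Poly_Mapping.keys r"
    define M where "M = {a \<in> ?k. w a = Max (w ` ?k)}"
    have "Max (w ` ?k) \<in> w ` ?k" using that by (intro Max_in) auto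
    then have "M \<noteq> {}" by (auto simp: M_def)
    moreover have "finite M" by (simp add: M_def)
    ultimately have "Max M \<in> M" "\<forall>a\<in>M. a \<le> Max M" by auto
    then show ?thesis by (intro bexI[of _ "Max M"]) (auto simp: M_def)
  qed
  obtain a where a: "a \<in> Poly_Mapping.keys p"
    "\<And>a'. a' \<in> Poly_Mapping.keys p \<Longrightarrow> w a' \<le> w a \<and> (w a' = w a \<longrightarrow> a' \<le> a)"
    using top[OF assms(1)] by auto
  obtain b where b: "b \<in> Poly_Mapping.keys q"
    "\<And>b'. b' \<in> Poly_Mapping.keys q \<Longrightarrow> w b' \<le> w b \<and> (w b' = w b \<longrightarrow> b' \<le> b)"
    using top[OF assms(2)] by auto
  have uniq: "a' + b' = a + b \<longleftrightarrow> a' = a \<and> b' = b"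
    if "a' \<in> Poly_Mapping.keys p" "b' \<in> Poly_Mapping.keys q" for a' b'
  proof
    assume eq: "a' + b' = a + b"
    then have "w a' + w b' = w a + w b" by (metis w)
    with a(2)[OF that(1)] b(2)[OF that(2)] have "a' \<le> a" "b' \<le> b" by auto
    with eq show "a' = a \<and> b' = b"
      by (metis add_less_le_mono add_le_less_mono less_irrefl order_le_less)
  qed simp
  have "Poly_Mapping.lookup (p * q) (a + b) = (\<Sum>a'\<in>Poly_Mapping.keys p. \<Sum>b'\<in>Poly_Mapping.keys q.
      if a' = a \<and> b' = b then Poly_Mapping.lookup p a' * Poly_Mapping.lookup q b' else 0)"
    unfolding lookup_mult_keys by (intro sum.cong refl) (simp add: uniq)
  also have "\<dots> = (\<Sum>a'\<in>Poly_Mapping.keys p. if a' = a then Poly_Mapping.lookup p a * Poly_Mapping.lookup q b else 0)"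
    using b(1) by (intro sum.cong refl) (auto simp: sum.delta)
  also have "\<dots> = Poly_Mapping.lookup p a * Poly_Mapping.lookup q b" using a(1) by (simp add: sum.delta)
  finally have "a + b \<in> Poly_Mapping.keys (p * q)" using a(1) b(1) by (simp add: in_keys_iff)
  then show ?thesis using that a b by blast
qed

text \<open>Both the largest and the smallest weights of the factors add up to \<open>d\<close>, so they coincide.\<close>

lemma factors_homogeneous:
  fixes p q :: "'a::{ordered_cancel_comm_monoid_add, linorder} \<Rightarrow>\<^sub>0 'b::idom" and w :: "'a \<Rightarrow> nat"
  assumes "p \<noteq> 0" "q \<noteq> 0" and w: "\<And>a b. w (a + b) = w a + w b"
    and hom: "\<And>m. m \<in> Poly_Mapping.keys (p * q) \<Longrightarrow> w m = d"
  obtains e f where "e + f = d" "\<And>a. a \<in> Poly_Mapping.keys p \<Longrightarrow> w a = e"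
    "\<And>b. b \<in> Poly_Mapping.keys q \<Longrightarrow> w b = f"
proof -
  obtain a b where ab: "a \<in> Poly_Mapping.keys p" "b \<in> Poly_Mapping.keys q" "a + b \<in> Poly_Mapping.keys (p * q)"
    "\<And>a'. a' \<in> Poly_Mapping.keys p \<Longrightarrow> int (w a') \<le> int (w a)"
    "\<And>b'. b' \<in> Poly_Mapping.keys q \<Longrightarrow> int (w b') \<le> int (w b)"
    using extremal_keys[OF assms(1,2), of "\<lambda>a. int (w a)"] w by auto
  obtain c d' where cd: "c \<in> Poly_Mapping.keys p" "d' \<in> Poly_Mapping.keys q" "c + d' \<in> Poly_Mapping.keys (p * q)"
    "\<And>a'. a' \<in> Poly_Mapping.keys p \<Longrightarrow> - int (w a') \<le> - int (w c)"
    "\<And>b'. b' \<in> Poly_Mapping.keys q \<Longrightarrow> - int (w b') \<le> - int (w d')"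
    using extremal_keys[OF assms(1,2), of "\<lambda>a. - int (w a)"] w by auto
  have "w a + w b = d" "w c + w d' = d" using hom ab(3) cd(3) w by metis+
  moreover have "w c \<le> w a" "w d' \<le> w b" using ab cd by auto
  ultimately have eq: "w c = w a" "w d' = w b" by auto
  show ?thesis
  proof (rule that)
    show "w a + w b = d" by fact
    show "w a' = w a" if "a' \<in> Poly_Mapping.keys p" for a'
      using ab(4)[OF that] cd(4)[OF that] eq by auto
    show "w b' = w b" if "b' \<in> Poly_Mapping.keys q" for b'
      using ab(5)[OF that] cd(5)[OF that] eq by auto
  qed
qed

text \<open>The exponent of \<open>t\<close> after row and column \<open>i\<close> of the matrix are scaled by \<open>t\<close>.\<close>

definition row_degree :: "nat set \<Rightarrow> nat \<Rightarrow> ((nat \<times> nat) \<Rightarrow>\<^sub>0 nat) \<Rightarrow> nat" where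
  "row_degree V i m = (\<Sum>j\<in>V - {i}. Poly_Mapping.lookup m (edge i j))"

lemma row_degree_add: "row_degree V i (a + b) = row_degree V i a + row_degree V i b"
  by (simp add: row_degree_def lookup_add sum.distrib)

lemma row_degree_zero [simp]: "row_degree V i 0 = 0"
  by (simp add: row_degree_def)

lemma row_degree_sum: "row_degree V i (sum f S) = (\<Sum>k\<in>S. row_degree V i (f k))"
  by (induction S rule: infinite_finite_induct) (simp_all add: row_degree_add)

lemma row_degree_edge:
  assumes "finite V" "k \<in> V" "l \<in> V" "k \<noteq> l"
  shows "row_degree V i (Poly_Mapping.single (edge k l) 1) = (if k = i then 1 else 0) + (if l = i then 1 else 0)"
proof -
  have "row_degree V i (Poly_Mapping.single (edge k l) 1) =
      (\<Sum>j\<in>V - {i}. (if k = i \<and> j = l then 1 else 0) + (if l = i \<and> j = k then 1 else 0))"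
    unfolding row_degree_def using assms(4)
    by (intro sum.cong) (auto simp: lookup_single when_def edge_eq_iff)
  also have "\<dots> = (if k = i then 1 else 0) + (if l = i then 1 else 0)"
    using assms by (auto simp: sum.delta)
  finally show ?thesis .
qed

text \<open>A vertex \<open>i\<close> lies on the edge leaving it and on the edge from its preimage under \<open>\<sigma>\<close>; a transposition
  counts its single edge twice.\<close>

lemma row_degree_cycle_monom:
  assumes "finite S" "\<sigma> \<in> derangements S" "i \<in> S"
  shows "row_degree S i (cycle_monom S \<sigma>) = 2"
proof -
  have p: "\<sigma> permutes S" using assms(2) by (rule derangementsD)
  have inv: "\<sigma> k = i \<longleftrightarrow> k = inv_into UNIV \<sigma> i" for k
    using permutes_inv_eq[OF p, of i k] by auto
  have "inv_into UNIV \<sigma> i \<in> S"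
    using assms(3) by (simp add: permutes_in_image[OF permutes_inv[OF p]])
  have "row_degree S i (cycle_monom S \<sigma>) = (\<Sum>k\<in>S. (if k = i then 1 else 0) + (if \<sigma> k = i then 1 else 0))"
    unfolding cycle_monom_def row_degree_sum
  proof (rule sum.cong[OF refl])
    fix k assume "k \<in> S"
    then show "row_degree S i (Poly_Mapping.single (edge k (\<sigma> k)) 1) =
        (if k = i then 1 else 0) + (if \<sigma> k = i then 1 else 0)"
      by (intro row_degree_edge assms(1) derangementsD(3,4)[OF assms(2)])
  qed
  also have "\<dots> = (\<Sum>k\<in>S. if k = i then 1 else 0) + (\<Sum>k\<in>S. if k = inv_into UNIV \<sigma> i then 1 else 0)"
    by (simp only: sum.distrib inv)
  also have "\<dots> = 2"
    using assms(1,3) \<open>inv_into UNIV \<sigma> i \<in> S\<close> by simp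
  finally show ?thesis .
qed

lemma det_coeff_nonzeroD:
  assumes "det_coeff S m \<noteq> 0"
  obtains \<sigma> where "\<sigma> \<in> derangements S" "m = cycle_monom S \<sigma>"
proof -
  have "{\<sigma>. \<sigma> \<in> derangements S \<and> cycle_monom S \<sigma> = m} \<noteq> {}"
    using assms unfolding det_coeff_def by (metis sum.empty)
  then show ?thesis using that by auto
qed

lemma keys_cycle_monom:
  assumes "\<sigma> \<in> derangements S"
  shows "Poly_Mapping.keys (cycle_monom S \<sigma>) \<subseteq> edges_on S"
proof -
  have "Poly_Mapping.keys (cycle_monom S \<sigma>) \<subseteq> (\<Union>i\<in>S. {edge i (\<sigma> i)})"
    unfolding cycle_monom_def by (rule order_trans[OF Poly_Mapping.keys_sum]) auto
  also have "\<dots> \<subseteq> edges_on S"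
    using derangementsD(3,4)[OF assms] by (auto simp: edge_in_edges_on simp del: split_paired_All)
  finally show ?thesis .
qed

lemma lookup_cycle_monom_pos:
  assumes "finite S" "i \<in> S"
  shows "Poly_Mapping.lookup (cycle_monom S \<sigma>) (edge i (\<sigma> i)) > 0"
proof -
  have "0 < (\<Sum>k\<in>S. Poly_Mapping.lookup (Poly_Mapping.single (edge k (\<sigma> k)) (1::nat)) (edge i (\<sigma> i)))"
    using assms by (intro sum_pos2[of S i]) auto
  then show ?thesis by (simp add: cycle_monom_def lookup_sum)
qed

section \<open>Monomials of the determinant built from a perfect matching\<close>

lemma lookup_edge_outside:
  assumes "Poly_Mapping.keys m \<subseteq> edges_on S" "i \<notin> S"
  shows "Poly_Mapping.lookup m (edge i j) = 0"
  using assms edge_in_edges_on[of i j S] by (auto simp: in_keys_iff)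

lemma single_two: "Poly_Mapping.single e (2::nat) = Poly_Mapping.single e 1 + Poly_Mapping.single e 1"
  by (subst single_add[symmetric]) (simp del: One_nat_def)

text \<open>If no other edge of the monomial meets \<open>x\<close> and \<open>y\<close>, a derangement with this monomial must swap the
  two. Removing the swap is a bijection onto the derangements of the remaining set and changes the sign.\<close>

lemma det_coeff_double:
  assumes "finite S" "x \<notin> S" "y \<notin> S" "x \<noteq> y" "Poly_Mapping.keys m \<subseteq> edges_on S"
  shows "det_coeff (insert x (insert y S)) (m + Poly_Mapping.single (edge x y) 2) = - det_coeff S m"
proof -
  let ?S = "insert x (insert y S)" and ?m = "m + Poly_Mapping.single (edge x y) 2"
  let ?t = "\<lambda>\<tau>. transpose x y \<circ> \<tau>"
  let ?A = "{\<tau>. \<tau> \<in> derangements S \<and> cycle_monom S \<tau> = m}"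
  let ?B = "{\<sigma>. \<sigma> \<in> derangements ?S \<and> cycle_monom ?S \<sigma> = ?m}"
  have forced: "\<sigma> x = y" "\<sigma> y = x" if "\<sigma> \<in> ?B" for \<sigma>
  proof -
    have pos: "Poly_Mapping.lookup ?m (edge k (\<sigma> k)) > 0" if "k \<in> ?S" for k
      using lookup_cycle_monom_pos[of ?S k \<sigma>] that \<open>\<sigma> \<in> ?B\<close> assms(1) by auto
    have "Poly_Mapping.lookup ?m (edge x j) = 0" if "j \<noteq> y" for j
      using that assms by (auto simp: lookup_add lookup_single when_def edge_eq_iff lookup_edge_outside)
    then show "\<sigma> x = y" using pos[of x] by (metis insertI1 less_irrefl)
    have "Poly_Mapping.lookup ?m (edge y j) = 0" if "j \<noteq> x" for j
      using that assms by (auto simp: lookup_add lookup_single when_def edge_eq_iff lookup_edge_outside)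
    then show "\<sigma> y = x" using pos[of y] by (metis insertI1 insertI2 less_irrefl)
  qed
  have monom: "cycle_monom ?S \<sigma> = cycle_monom S (?t \<sigma>) + Poly_Mapping.single (edge x y) 2"
    if "\<sigma> permutes ?S" "\<sigma> x = y" "\<sigma> y = x" for \<sigma>
  proof -
    have "cycle_monom S (?t \<sigma>) = cycle_monom S \<sigma>"
      unfolding cycle_monom_def
    proof (rule sum.cong[OF refl])
      fix i assume "i \<in> S"
      then have "\<sigma> i \<noteq> \<sigma> y" "\<sigma> i \<noteq> \<sigma> x"
        using assms(2,3) permutes_inj[OF that(1)] by (auto simp: inj_eq)
      then show "Poly_Mapping.single (edge i (?t \<sigma> i)) 1 = Poly_Mapping.single (edge i (\<sigma> i)) (1::nat)"
        using that by (simp add: transpose_def)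
    qed
    moreover have "cycle_monom ?S \<sigma> = Poly_Mapping.single (edge x y) 1 + (Poly_Mapping.single (edge y x) 1 + cycle_monom S \<sigma>)"
      using assms that by (simp add: cycle_monom_def)
    ultimately show ?thesis
      by (simp only: single_two edge_commute[of y x] ac_simps)
  qed
  have perm: "transpose x y permutes ?S" by (intro permutes_swap_id) auto
  have sgn: "sign (?t \<sigma>) = - sign \<sigma>" if "\<sigma> permutes ?S" for \<sigma>
  proof -
    have "permutation \<sigma>" "permutation (transpose x y)"
      by (rule permutes_imp_permutation[of ?S]; use that perm assms(1) in simp)+
    then show ?thesis using assms(4) by (simp add: sign_compose sign_swap_id)
  qed
  have down: "?t \<sigma> \<in> ?A" if s: "\<sigma> \<in> ?B" for \<sigma>
  proof -
    have p: "\<sigma> permutes ?S" and d: "\<And>i. i \<in> ?S \<Longrightarrow> \<sigma> i \<noteq> i"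
      using s by (auto simp: derangements_def)
    note f = forced[OF s]
    have "?t \<sigma> permutes S"
      by (rule permutes_superset[OF permutes_compose[OF p perm]]) (use f in auto)
    moreover have "?t \<sigma> i \<noteq> i" if "i \<in> S" for i
    proof -
      have "\<sigma> i \<noteq> \<sigma> y" "\<sigma> i \<noteq> \<sigma> x"
        using that assms(2,3) permutes_inj[OF p] by (auto simp: inj_eq)
      then show ?thesis using d[of i] that f by (simp add: transpose_def)
    qed
    moreover have "cycle_monom S (?t \<sigma>) = m" using monom[OF p f] s by simp
    ultimately show ?thesis by (simp add: derangements_def)
  qed
  have up: "?t \<tau> \<in> ?B" if t: "\<tau> \<in> ?A" for \<tau>
  proof -
    have p: "\<tau> permutes S" and d: "\<And>i. i \<in> S \<Longrightarrow> \<tau> i \<noteq> i"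
      using t by (auto simp: derangements_def)
    have p': "?t \<tau> permutes ?S"
      by (intro permutes_compose perm permutes_subset[OF p]) auto
    have xy: "\<tau> x = x" "\<tau> y = y" using p assms by (auto simp: permutes_def)
    have id: "?t (?t \<tau>) = \<tau>" by (simp add: fun_eq_iff)
    have "cycle_monom ?S (?t \<tau>) = ?m"
      using monom[OF p'] t xy unfolding id by simp
    moreover have "?t \<tau> i \<noteq> i" if "i \<in> S" for i
      using d[OF that] permutes_in_image[OF p, of i] that assms by (auto simp: transpose_def)
    ultimately show ?thesis using p' xy assms(4) by (auto simp: derangements_def)
  qed
  have "det_coeff ?S ?m = (\<Sum>\<tau>\<in>?A. - sign \<tau>)"
    unfolding det_coeff_def
  proof (rule sum.reindex_bij_witness[where i = ?t and j = ?t])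
    fix \<sigma> assume s: "\<sigma> \<in> ?B"
    show "?t (?t \<sigma>) = \<sigma>" by (simp add: fun_eq_iff)
    show "?t \<sigma> \<in> ?A" using s by (rule down)
    have "\<sigma> permutes ?S" using s by (auto dest: derangementsD)
    then show "- sign (?t \<sigma>) = sign \<sigma>" by (simp only: sgn minus_minus)
  next
    fix \<tau> assume t: "\<tau> \<in> ?A"
    show "?t (?t \<tau>) = \<tau>" by (simp add: fun_eq_iff)
    show "?t \<tau> \<in> ?B" using t by (rule up)
  qed
  then show ?thesis by (simp add: sum_negf det_coeff_def)
qed

text \<open>The squarefree monomials of perfect matchings. Building them edge by edge lets coefficients be
  computed by repeated use of the previous lemma.\<close>

inductive perfect_matching :: "nat set \<Rightarrow> ((nat \<times> nat) \<Rightarrow>\<^sub>0 nat) \<Rightarrow> bool" where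
  empty: "perfect_matching {} 0"
| insert: "perfect_matching S r \<Longrightarrow> x \<notin> S \<Longrightarrow> y \<notin> S \<Longrightarrow> x \<noteq> y \<Longrightarrow>
    perfect_matching (insert x (insert y S)) (r + Poly_Mapping.single (edge x y) 1)"

lemma edges_on_mono: "S \<subseteq> T \<Longrightarrow> edges_on S \<subseteq> edges_on T"
  by (auto simp: edges_on_def)

lemma keys_add_edge:
  fixes m :: "(nat \<times> nat) \<Rightarrow>\<^sub>0 nat"
  assumes "Poly_Mapping.keys m \<subseteq> edges_on S" "x \<noteq> y"
  shows "Poly_Mapping.keys (m + Poly_Mapping.single (edge x y) k) \<subseteq> edges_on (insert x (insert y S))"
proof
  fix e assume "e \<in> Poly_Mapping.keys (m + Poly_Mapping.single (edge x y) k)"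
  then have "e \<in> Poly_Mapping.keys m \<or> e = edge x y"
    by (auto simp: in_keys_iff lookup_add lookup_single when_def split: if_splits)
  then show "e \<in> edges_on (insert x (insert y S))"
    using assms edges_on_mono[of S "insert x (insert y S)"] by (auto simp: edge_in_edges_on)
qed

lemma keys_matching: "perfect_matching S r \<Longrightarrow> Poly_Mapping.keys r \<subseteq> edges_on S"
  by (induction rule: perfect_matching.induct) (simp_all add: keys_add_edge)

lemma matching_exists:
  assumes "finite S" "even (card S)"
  shows "\<exists>r. perfect_matching S r"
  using assms
proof (induction "card S" arbitrary: S rule: less_induct)
  case less
  show ?case
  proof (cases "S = {}")
    case False
    then obtain x where x: "x \<in> S" by auto
    have "S - {x} \<noteq> {}"
    proof
      assume "S - {x} = {}"
      then have "S = {x}" using x by auto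
      then show False using less.prems by simp
    qed
    then obtain y where y: "y \<in> S" "y \<noteq> x" by auto
    have S: "S = insert x (insert y (S - {x, y}))" using x y by auto
    have "card S = card (S - {x, y}) + 2"
      using x y less.prems(1) by (subst S) (auto simp: card_insert_if)
    then obtain r where "perfect_matching (S - {x, y}) r"
      using less.hyps[of "S - {x, y}"] less.prems by auto
    from perfect_matching.insert[OF this, of x y] y S show ?thesis by auto
  qed (auto intro: perfect_matching.empty)
qed

text \<open>The sign \<open>s\<close> depends on \<open>S\<close> alone. Comparing different monomials \<open>m\<close> completed by the same doubled
  matching relies on this.\<close>

lemma matching_det_coeff:
  assumes "perfect_matching S r"
  obtains s :: int where "s \<in> {1, -1}"
    "\<And>T m. finite T \<Longrightarrow> T \<inter> S = {} \<Longrightarrow> Poly_Mapping.keys m \<subseteq> edges_on T \<Longrightarrow>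
       det_coeff (T \<union> S) (m + (r + r)) = s * det_coeff T m"
proof -
  have "\<exists>s\<in>{1, -1 :: int}. \<forall>T m. finite T \<longrightarrow> T \<inter> S = {} \<longrightarrow> Poly_Mapping.keys m \<subseteq> edges_on T \<longrightarrow>
       det_coeff (T \<union> S) (m + (r + r)) = s * det_coeff T m"
    using assms
  proof (induction rule: perfect_matching.induct)
    case (insert S r x y)
    then obtain s :: int where s: "s \<in> {1, -1}"
      "\<And>T m. finite T \<Longrightarrow> T \<inter> S = {} \<Longrightarrow> Poly_Mapping.keys m \<subseteq> edges_on T \<Longrightarrow>
       det_coeff (T \<union> S) (m + (r + r)) = s * det_coeff T m" by blast
    show ?case
    proof (intro bexI[of _ "- s"] allI impI)
      fix T and m :: "(nat \<times> nat) \<Rightarrow>\<^sub>0 nat"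
      assume T: "finite T" "T \<inter> insert x (insert y S) = {}" "Poly_Mapping.keys m \<subseteq> edges_on T"
      let ?e = "Poly_Mapping.single (edge x y)"
      have "det_coeff (insert x (insert y T) \<union> S) ((m + ?e 2) + (r + r)) =
          s * det_coeff (insert x (insert y T)) (m + ?e 2)"
        using T insert.hyps keys_add_edge[OF T(3) insert.hyps(4)] by (intro s(2)) auto
      also have "\<dots> = - s * det_coeff T m"
        using T insert.hyps by (subst det_coeff_double) auto
      also have "(m + ?e 2) + (r + r) = m + ((r + ?e 1) + (r + ?e 1))"
        by (simp only: single_two ac_simps)
      also have "insert x (insert y T) \<union> S = T \<union> insert x (insert y S)" by auto
      finally show "det_coeff (T \<union> insert x (insert y S)) (m + (r + ?e 1 + (r + ?e 1))) = - s * det_coeff T m" .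
    qed (use s in auto)
  qed auto
  then show ?thesis using that by blast
qed

lemma row_degree_one_neighbour:
  assumes "finite V" "y \<in> V" "x \<noteq> y" "\<And>k. k \<in> V \<Longrightarrow> k \<noteq> x \<Longrightarrow> k \<noteq> y \<Longrightarrow> Poly_Mapping.lookup p (edge x k) = 0"
  shows "row_degree V x p = Poly_Mapping.lookup p (edge x y)"
proof -
  have "row_degree V x p = Poly_Mapping.lookup p (edge x y) + (\<Sum>j\<in>V - {x} - {y}. Poly_Mapping.lookup p (edge x j))"
    unfolding row_degree_def using assms by (intro sum.remove) auto
  then show ?thesis using assms by simp
qed

lemma sum_zero_lookup:
  fixes p q :: "'a \<Rightarrow>\<^sub>0 nat"
  shows "p + q = m \<Longrightarrow> Poly_Mapping.lookup m e = 0 \<Longrightarrow> Poly_Mapping.lookup p e = 0"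
  by (auto simp: lookup_add)

text \<open>Above a doubled matching there is no choice: the only edge available at a vertex \<open>x\<close> of \<open>S\<close> is its
  matching edge, so a summand with degree 1 at \<open>x\<close> contains this edge exactly once.\<close>

lemma matching_split:
  assumes "perfect_matching S r" "finite V" "S \<subseteq> V" "T \<inter> S = {}" "Poly_Mapping.keys m \<subseteq> edges_on T"
    "p + q = m + (r + r)" "\<And>x. x \<in> S \<Longrightarrow> row_degree V x p = 1"
  shows "\<exists>p' q'. p = p' + r \<and> q = q' + r \<and> p' + q' = m"
  using assms
proof (induction arbitrary: p q rule: perfect_matching.induct)
  case (insert S r x y)
  let ?e = "Poly_Mapping.single (edge x y) (1::nat)"
  have r: "Poly_Mapping.keys r \<subseteq> edges_on S" using insert.hyps(1) by (rule keys_matching)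
  have T: "x \<notin> T" "y \<notin> T" using insert.prems(3) by auto
  have tot: "Poly_Mapping.lookup (m + (r + ?e + (r + ?e))) (edge x k) = (if k = y then 2 else 0)" for k
    using insert.hyps T lookup_edge_outside[OF r] lookup_edge_outside[OF insert.prems(4)]
    by (auto simp: lookup_add lookup_single when_def edge_eq_iff)
  have "row_degree V x p = Poly_Mapping.lookup p (edge x y)"
  proof (rule row_degree_one_neighbour)
    fix k assume "k \<noteq> y"
    then show "Poly_Mapping.lookup p (edge x k) = 0"
      using sum_zero_lookup[OF insert.prems(5)] tot by auto
  qed (use insert in auto)
  then have pe: "Poly_Mapping.lookup p (edge x y) = 1" using insert.prems(6)[of x] by simp
  then have qe: "Poly_Mapping.lookup q (edge x y) = 1"
    using tot[of y] unfolding insert.prems(5)[symmetric] by (simp add: lookup_add)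
  have split: "u = (u - ?e) + ?e" if "Poly_Mapping.lookup u (edge x y) = 1" for u :: "(nat \<times> nat) \<Rightarrow>\<^sub>0 nat"
    using that by (intro poly_mapping_eqI) (auto simp: lookup_add lookup_minus lookup_single when_def)
  define p1 q1 where "p1 = p - ?e" and "q1 = q - ?e"
  have p: "p = p1 + ?e" and q: "q = q1 + ?e"
    unfolding p1_def q1_def using split pe qe by blast+
  have "(p1 + q1) + (?e + ?e) = (m + (r + r)) + (?e + ?e)"
    using insert.prems(5) unfolding p q by (simp only: ac_simps)
  then have pq: "p1 + q1 = m + (r + r)" by (rule add_right_imp_eq)
  have "row_degree V z p1 = 1" if "z \<in> S" for z
  proof -
    have "row_degree V z p = row_degree V z p1 + row_degree V z ?e" by (simp only: p row_degree_add)
    moreover have "row_degree V z ?e = 0"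
      using insert.prems(1,2) insert.hyps that by (subst row_degree_edge) auto
    ultimately show ?thesis using insert.prems(6)[of z] that by simp
  qed
  then obtain p' q' where "p1 = p' + r" "q1 = q' + r" "p' + q' = m"
    using insert.IH[OF insert.prems(1) _ _ insert.prems(4) pq] insert.prems(2,3) by blast
  then show ?case unfolding p q by (intro exI[of _ p'] exI[of _ q']) (simp add: add.assoc)
qed auto

lemma permutes_eqI:
  assumes "\<sigma> permutes S" "\<tau> permutes S" "\<And>x. x \<in> S \<Longrightarrow> \<sigma> x = \<tau> x"
  shows "\<sigma> = \<tau>"
  using assms by (metis ext permutes_not_in)

lemma det_coeff_empty [simp]: "det_coeff {} 0 = 1"
proof -
  have "{\<sigma>. \<sigma> \<in> derangements {} \<and> cycle_monom {} \<sigma> = 0} = {id}"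
    by (auto simp: derangements_def cycle_monom_def permutes_empty)
  then show ?thesis by (simp add: det_coeff_def)
qed

lemma det_coeff_triangle:
  assumes "distinct [a, b, c]"
  shows "det_coeff {a, b, c} (Poly_Mapping.single (edge a b) 1 + Poly_Mapping.single (edge b c) 1 +
    Poly_Mapping.single (edge c a) 1) = 2" (is "det_coeff ?S ?m = 2")
proof -
  define f where "f = transpose a b \<circ> transpose b c"
  define g where "g = transpose a c \<circ> transpose c b"
  have fv: "f a = b" "f b = c" "f c = a" and gv: "g a = c" "g c = b" "g b = a"
    using assms by (auto simp: f_def g_def transpose_def)
  have fp: "f permutes ?S" and gp: "g permutes ?S"
    unfolding f_def g_def by (intro permutes_compose permutes_swap_id; simp)+
  have "sign f = 1" "sign g = 1"
    unfolding f_def g_def using assms by (simp_all add: sign_compose sign_swap_id permutation_swap_id)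
  moreover have "f \<noteq> g" using fv(1) gv(1) assms by auto
  moreover have "{\<sigma>. \<sigma> \<in> derangements ?S \<and> cycle_monom ?S \<sigma> = ?m} = {f, g}" (is "?A = _")
  proof (intro equalityI subsetI)
    fix \<sigma> assume "\<sigma> \<in> {f, g}"
    moreover have "cycle_monom ?S f = ?m" using assms by (simp add: cycle_monom_def fv ac_simps)
    moreover have "cycle_monom ?S g = ?m"
      using assms by (simp add: cycle_monom_def gv edge_commute[of a c] edge_commute[of c b]
        edge_commute[of b a] ac_simps)
    moreover have "f \<in> derangements ?S" "g \<in> derangements ?S"
      unfolding derangements_def using assms fp gp by (simp_all add: fv gv eq_commute)
    ultimately show "\<sigma> \<in> ?A" by blast
  next
    fix \<sigma> assume "\<sigma> \<in> ?A"
    then have s: "\<sigma> \<in> derangements ?S" by simp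
    have p: "\<sigma> permutes ?S" using s by (rule derangementsD)
    have i: "\<sigma> a \<noteq> \<sigma> b" "\<sigma> a \<noteq> \<sigma> c" "\<sigma> b \<noteq> \<sigma> c"
      using permutes_inj[OF p] assms by (auto simp: inj_eq)
    have v: "\<sigma> a \<in> {b, c}" "\<sigma> b \<in> {a, c}" "\<sigma> c \<in> {a, b}"
      using derangementsD(2,4)[OF s, of a] derangementsD(2,4)[OF s, of b] derangementsD(2,4)[OF s, of c] by auto
    show "\<sigma> \<in> {f, g}"
    proof (cases "\<sigma> a = b")
      case True
      then have "\<sigma> = f" using v i fv assms by (intro permutes_eqI[OF p fp]) auto
      then show ?thesis by simp
    next
      case False
      then have "\<sigma> = g" using v i gv assms by (intro permutes_eqI[OF p gp]) auto
      then show ?thesis by simp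
    qed
  qed
  ultimately show ?thesis by (simp add: det_coeff_def)
qed

text \<open>Only the two orientations of the cycle contribute: a derangement following one of the edges cannot
  return along it, as no edge is doubled.\<close>

lemma det_coeff_four_cycle:
  assumes "distinct [a, b, c, d]"
  shows "det_coeff {a, b, c, d} (Poly_Mapping.single (edge a b) 1 + Poly_Mapping.single (edge b c) 1 +
    Poly_Mapping.single (edge c d) 1 + Poly_Mapping.single (edge d a) 1) = - 2" (is "det_coeff ?S ?m = - 2")
proof -
  define f where "f = transpose a b \<circ> (transpose b c \<circ> transpose c d)"
  define g where "g = transpose a d \<circ> (transpose d c \<circ> transpose c b)"
  have fv: "f a = b" "f b = c" "f c = d" "f d = a" and gv: "g a = d" "g d = c" "g c = b" "g b = a"
    using assms by (auto simp: f_def g_def transpose_def)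
  have fp: "f permutes ?S" and gp: "g permutes ?S"
    unfolding f_def g_def by (intro permutes_compose permutes_swap_id; simp)+
  have "sign f = - 1" "sign g = - 1"
    unfolding f_def g_def using assms
    by (simp_all add: sign_compose sign_swap_id permutation_swap_id permutation_compose)
  moreover have "f \<noteq> g" using fv(1) gv(1) assms by auto
  moreover have "{\<sigma>. \<sigma> \<in> derangements ?S \<and> cycle_monom ?S \<sigma> = ?m} = {f, g}" (is "?A = _")
  proof (intro equalityI subsetI)
    fix \<sigma> assume "\<sigma> \<in> {f, g}"
    moreover have "cycle_monom ?S f = ?m" using assms by (simp add: cycle_monom_def fv ac_simps)
    moreover have "cycle_monom ?S g = ?m"
      using assms by (simp add: cycle_monom_def gv edge_commute[of a d] edge_commute[of d c]
        edge_commute[of c b] edge_commute[of b a] ac_simps)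
    moreover have "f \<in> derangements ?S" "g \<in> derangements ?S"
      unfolding derangements_def using assms fp gp by (simp_all add: fv gv eq_commute)
    ultimately show "\<sigma> \<in> ?A" by blast
  next
    fix \<sigma> assume A: "\<sigma> \<in> ?A"
    then have s: "\<sigma> \<in> derangements ?S" and m: "cycle_monom ?S \<sigma> = ?m" by auto
    have p: "\<sigma> permutes ?S" using s by (rule derangementsD)
    have i: "\<sigma> a \<noteq> \<sigma> b" "\<sigma> a \<noteq> \<sigma> c" "\<sigma> a \<noteq> \<sigma> d" "\<sigma> b \<noteq> \<sigma> c" "\<sigma> b \<noteq> \<sigma> d" "\<sigma> c \<noteq> \<sigma> d"
      using permutes_inj[OF p] assms by (auto simp: inj_eq)
    have pos: "Poly_Mapping.lookup ?m (edge k (\<sigma> k)) > 0" if "k \<in> ?S" for k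
      unfolding m[symmetric] using that by (intro lookup_cycle_monom_pos) auto
    have lk: "Poly_Mapping.lookup ?m (edge a c) = 0" "Poly_Mapping.lookup ?m (edge b d) = 0"
      "Poly_Mapping.lookup ?m (edge a b) = 1" "Poly_Mapping.lookup ?m (edge a d) = 1"
      using assms by (auto simp: lookup_add lookup_single when_def edge_eq_iff)
    have opp: "\<sigma> a \<noteq> c" "\<sigma> c \<noteq> a" "\<sigma> b \<noteq> d" "\<sigma> d \<noteq> b"
    proof -
      have "\<sigma> k \<noteq> l" if "k \<in> ?S" "Poly_Mapping.lookup ?m (edge k l) = 0" for k l
        using pos[OF that(1)] that(2) by (metis less_irrefl)
      note this[of a c] this[of c a] this[of b d] this[of d b]
      then show "\<sigma> a \<noteq> c" "\<sigma> c \<noteq> a" "\<sigma> b \<noteq> d" "\<sigma> d \<noteq> b"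
        unfolding edge_commute[of c a] edge_commute[of d b] lk(1,2) by blast+
    qed
    have v: "\<sigma> a \<in> {b, d}" "\<sigma> b \<in> {a, c}" "\<sigma> c \<in> {b, d}" "\<sigma> d \<in> {a, c}"
      using derangementsD(2,4)[OF s, of a] opp(1) apply blast
      using derangementsD(2,4)[OF s, of b] opp(3) apply blast
      using derangementsD(2,4)[OF s, of c] opp(2) apply blast
      using derangementsD(2,4)[OF s, of d] opp(4) by blast
    have m': "cycle_monom ?S \<sigma> = Poly_Mapping.single (edge a (\<sigma> a)) 1 + (Poly_Mapping.single (edge b (\<sigma> b)) 1 +
        (Poly_Mapping.single (edge c (\<sigma> c)) 1 + Poly_Mapping.single (edge d (\<sigma> d)) 1))"
      using assms by (simp add: cycle_monom_def)
    show "\<sigma> \<in> {f, g}"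
    proof (cases "\<sigma> a = b")
      case True
      have "\<sigma> b \<noteq> a"
      proof
        assume "\<sigma> b = a"
        then have "Poly_Mapping.lookup (cycle_monom ?S \<sigma>) (edge a b) \<ge> 2"
          unfolding m' True by (simp add: lookup_add lookup_single edge_commute[of b a])
        then show False unfolding m using lk(3) by simp
      qed
      then have bc: "\<sigma> b = c" using v(2) by simp
      have cd: "\<sigma> c = d" using v(3) i(2) True by auto
      have da: "\<sigma> d = a" using v(4) i(5) bc by auto
      have "\<sigma> = f"
        by (rule permutes_eqI[OF p fp]) (elim insertE emptyE; simp only: fv True bc cd da)
      then show ?thesis by simp
    next
      case False
      then have ad: "\<sigma> a = d" using v by simp
      have "\<sigma> d \<noteq> a"
      proof
        assume "\<sigma> d = a"
        then have "Poly_Mapping.lookup (cycle_monom ?S \<sigma>) (edge a d) \<ge> 2"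
          unfolding m' ad by (simp add: lookup_add lookup_single edge_commute[of d a])
        then show False unfolding m using lk(4) by simp
      qed
      then have dc: "\<sigma> d = c" using v(4) by simp
      have cb: "\<sigma> c = b" using v(3) i(2) ad by auto
      have ba: "\<sigma> b = a" using v(2) i(5) dc by auto
      have "\<sigma> = g"
        by (rule permutes_eqI[OF p gp]) (elim insertE emptyE; simp only: gv ad dc cb ba)
      then show ?thesis by simp
    qed
  qed
  ultimately show ?thesis by (simp add: det_coeff_def)
qed

text \<open>A doubled perfect matching is the monomial of one involution; in odd cardinality a triangle is added,
  which has two orientations of equal sign.\<close>

lemma det_coeff_primitive:
  assumes "finite R" "card R \<noteq> 1"
  obtains m where "\<bar>det_coeff R m\<bar> = (if even (card R) then 1 else 2)"
proof (cases "even (card R)")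
  case True
  then obtain r where r: "perfect_matching R r" using matching_exists assms(1) by blast
  from matching_det_coeff[OF r] obtain s :: int where s: "s \<in> {1, -1}"
    "\<And>T m. finite T \<Longrightarrow> T \<inter> R = {} \<Longrightarrow> Poly_Mapping.keys m \<subseteq> edges_on T \<Longrightarrow>
       det_coeff (T \<union> R) (m + (r + r)) = s * det_coeff T m" by blast
  have "det_coeff R (r + r) = s" using s(2)[of "{}" 0] by simp
  then show ?thesis using True s(1) by (intro that[of "r + r"]) auto
next
  case False
  with assms(2) have "card R \<ge> 3" by (cases "card R = 2") (auto, presburger)
  then obtain T where "T \<subseteq> R" "card T = 3" using obtain_subset_with_card_n by metis
  then obtain a b c where abc: "T = {a, b, c}" "distinct [a, b, c]"
    by (auto simp: card_3_iff)
  have "card (R - T) = card R - 3" using \<open>T \<subseteq> R\<close> \<open>card T = 3\<close> assms(1)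
    by (simp add: card_Diff_subset finite_subset)
  then have "even (card (R - T))" using False \<open>card R \<ge> 3\<close> by simp
  then obtain r where r: "perfect_matching (R - T) r" using matching_exists assms(1) by blast
  from matching_det_coeff[OF r] obtain s :: int where s: "s \<in> {1, -1}"
    "\<And>T' m. finite T' \<Longrightarrow> T' \<inter> (R - T) = {} \<Longrightarrow> Poly_Mapping.keys m \<subseteq> edges_on T' \<Longrightarrow>
       det_coeff (T' \<union> (R - T)) (m + (r + r)) = s * det_coeff T' m" by blast
  let ?m = "Poly_Mapping.single (edge a b) 1 + Poly_Mapping.single (edge b c) 1 +
    Poly_Mapping.single (edge c a) (1::nat)"
  have tri: "det_coeff T ?m = 2" unfolding abc(1) by (rule det_coeff_triangle[OF abc(2)])
  then obtain \<sigma> where "\<sigma> \<in> derangements T" "?m = cycle_monom T \<sigma>" by (elim det_coeff_nonzeroD[rotated]) simp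
  then have "Poly_Mapping.keys ?m \<subseteq> edges_on T" using keys_cycle_monom by metis
  then have "det_coeff (T \<union> (R - T)) (?m + (r + r)) = s * 2"
    using \<open>T \<subseteq> R\<close> assms(1) s(2)[of T ?m] tri by (auto dest: finite_subset)
  moreover have "T \<union> (R - T) = R" using \<open>T \<subseteq> R\<close> by auto
  ultimately show ?thesis using False s(1) by (intro that[of "?m + (r + r)"]) auto
qed

lemma keys_of_det_coeff:
  "det_coeff S m \<noteq> 0 \<Longrightarrow> Poly_Mapping.keys m \<subseteq> edges_on S"
  by (elim det_coeff_nonzeroD) (simp add: keys_cycle_monom)

section \<open>Decompositions of determinant monomials\<close>

lemma row_degree_subset:
  assumes "finite V" "T \<subseteq> V" "Poly_Mapping.keys m \<subseteq> edges_on T"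
  shows "row_degree V i m = row_degree T i m"
  unfolding row_degree_def
proof (rule sum.mono_neutral_right)
  show "\<forall>j\<in>V - {i} - (T - {i}). Poly_Mapping.lookup m (edge i j) = 0"
    using assms(3) lookup_edge_outside by (metis Diff_iff edge_commute)
qed (use assms in auto)

lemma row_degree_outside:
  assumes "Poly_Mapping.keys m \<subseteq> edges_on S" "i \<notin> S"
  shows "row_degree V i m = 0"
  unfolding row_degree_def by (intro sum.neutral ballI lookup_edge_outside[OF assms])

lemma row_degrees_zeroD:
  assumes "finite V" "Poly_Mapping.keys m \<subseteq> edges_on V" "\<And>i. i \<in> V \<Longrightarrow> row_degree V i m = 0"
  shows "m = 0"
proof (rule poly_mapping_eqI)
  fix e
  show "Poly_Mapping.lookup m e = Poly_Mapping.lookup 0 e"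
  proof (cases "e \<in> edges_on V")
    case True
    then obtain i j where e: "e = edge i j" "i \<in> V" "j \<in> V" "i \<noteq> j" by (auto simp: edges_on_def)
    have "\<forall>j\<in>V - {i}. Poly_Mapping.lookup m (edge i j) = 0"
      using assms(1,3) e(2) by (simp add: row_degree_def)
    then show ?thesis using e by auto
  next
    case False
    then show ?thesis using assms(2) by (auto simp: in_keys_iff)
  qed
qed

lemma keys_summand:
  fixes p q :: "'a \<Rightarrow>\<^sub>0 nat"
  assumes "p + q = m"
  shows "Poly_Mapping.keys p \<subseteq> Poly_Mapping.keys m" "Poly_Mapping.keys q \<subseteq> Poly_Mapping.keys m"
  using assms by (auto simp: in_keys_iff lookup_add)

lemma lookup_mult_decompositions:
  fixes p q :: "'a::comm_monoid_add \<Rightarrow>\<^sub>0 'b::comm_semiring_1"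
  assumes "finite D" "\<And>a b. (a, b) \<in> D \<Longrightarrow> a + b = m"
    "\<And>a b. a \<in> Poly_Mapping.keys p \<Longrightarrow> b \<in> Poly_Mapping.keys q \<Longrightarrow> a + b = m \<Longrightarrow> (a, b) \<in> D"
  shows "Poly_Mapping.lookup (p * q) m = (\<Sum>(a, b)\<in>D. Poly_Mapping.lookup p a * Poly_Mapping.lookup q b)"
proof -
  let ?K = "Poly_Mapping.keys p \<times> Poly_Mapping.keys q"
  let ?f = "\<lambda>(a, b). Poly_Mapping.lookup p a * Poly_Mapping.lookup q b"
  have "Poly_Mapping.lookup (p * q) m = (\<Sum>z\<in>?K. if fst z + snd z = m then ?f z else 0)"
    unfolding lookup_mult_keys sum.cartesian_product by (intro sum.cong) auto
  also have "\<dots> = sum ?f {z \<in> ?K. fst z + snd z = m}"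
    by (intro sum.inter_filter[symmetric]) simp
  also have "\<dots> = sum ?f D"
  proof (rule sum.mono_neutral_left[OF assms(1)])
    show "{z \<in> ?K. fst z + snd z = m} \<subseteq> D" using assms(3) by auto
    show "\<forall>z\<in>D - {z \<in> ?K. fst z + snd z = m}. ?f z = 0"
    proof
      fix z assume z: "z \<in> D - {z \<in> ?K. fst z + snd z = m}"
      obtain a b where ab: "z = (a, b)" by (cases z)
      then have "a \<notin> Poly_Mapping.keys p \<or> b \<notin> Poly_Mapping.keys q" using z assms(2)[of a b] by auto
      then show "?f z = 0" by (auto simp: ab in_keys_iff)
    qed
  qed
  finally show ?thesis .
qed

text \<open>One of the three perfect matchings of a set of four vertices.\<close>

definition pairing :: "nat \<Rightarrow> nat \<Rightarrow> nat \<Rightarrow> nat \<Rightarrow> (nat \<times> nat) \<Rightarrow>\<^sub>0 nat" where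
  "pairing a b c d = Poly_Mapping.single (edge a b) 1 + Poly_Mapping.single (edge c d) 1"

lemma keys_pairing:
  assumes "distinct [a, b, c, d]" "{a, b, c, d} = T"
  shows "Poly_Mapping.keys (pairing a b c d) \<subseteq> edges_on T"
proof -
  have "Poly_Mapping.keys (pairing a b c d) \<subseteq> {edge a b} \<union> {edge c d}"
    unfolding pairing_def by (rule order_trans[OF Poly_Mapping.keys_add]) auto
  also have "\<dots> \<subseteq> edges_on T" using assms by (auto simp: edge_in_edges_on)
  finally show ?thesis .
qed

lemma det_coeff_pairing_square:
  assumes "distinct [a, b, c, d]"
  shows "det_coeff {a, b, c, d} (pairing a b c d + pairing a b c d) = 1"
proof -
  have eq: "pairing a b c d + pairing a b c d =
      (0 + Poly_Mapping.single (edge c d) 2) + Poly_Mapping.single (edge a b) 2"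
    unfolding pairing_def single_two by (simp only: ac_simps add_0_left)
  have k: "Poly_Mapping.keys (0 + Poly_Mapping.single (edge c d) (2::nat)) \<subseteq> edges_on (insert c (insert d {}))"
    using assms by (intro keys_add_edge) auto
  have "det_coeff {a, b, c, d} (pairing a b c d + pairing a b c d) =
      - det_coeff {c, d} (0 + Poly_Mapping.single (edge c d) 2)"
    unfolding eq using assms k by (intro det_coeff_double) auto
  also have "det_coeff {c, d} (0 + Poly_Mapping.single (edge c d) 2) = - det_coeff {} 0"
    using assms by (intro det_coeff_double) auto
  finally show ?thesis by simp
qed

lemma det_coeff_pairing_product:
  assumes "distinct [a, b, c, d]"
  shows "det_coeff {a, b, c, d} (pairing a b c d + pairing a c b d) = - 2"
proof -
  have "pairing a b c d + pairing a c b d = Poly_Mapping.single (edge a b) 1 + Poly_Mapping.single (edge b d) 1 +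
    Poly_Mapping.single (edge d c) 1 + Poly_Mapping.single (edge c a) 1"
    unfolding pairing_def edge_commute[of d c] edge_commute[of c a] by (simp only: ac_simps)
  moreover have "{a, b, c, d} = {a, b, d, c}" by auto
  ultimately show ?thesis using det_coeff_four_cycle[of a b d c] assms by auto
qed

text \<open>Two different pairings form a four-cycle, and a set of its edges with degree 1 at each vertex takes
  every other edge: the edge from \<open>a\<close> to \<open>c\<close> decides which of the two pairings it is.\<close>

lemma pairing_decompositions:
  assumes "distinct [a, b, c, d]" "p + q = pairing a b c d + M" "M = pairing a b c d \<or> M = pairing a c b d"
    "\<And>v. v \<in> {a, b, c, d} \<Longrightarrow> row_degree {a, b, c, d} v p = 1"
  shows "(p = pairing a b c d \<and> q = M) \<or> (p = M \<and> q = pairing a b c d)"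
proof -
  let ?T = "{a, b, c, d}" and ?L = "Poly_Mapping.lookup p"
  have M: "Poly_Mapping.keys M \<subseteq> edges_on ?T"
    using assms(1,3) keys_pairing[of a b c d ?T] keys_pairing[of a c b d ?T] by auto
  have "Poly_Mapping.keys (pairing a b c d + M) \<subseteq> edges_on ?T"
    using order_trans[OF Poly_Mapping.keys_add, of "pairing a b c d" M "edges_on ?T"] M
      keys_pairing[OF assms(1) refl] by auto
  with keys_summand(1)[OF assms(2)] have kp: "Poly_Mapping.keys p \<subseteq> edges_on ?T" by auto
  have eqI: "p = m" if "Poly_Mapping.keys m \<subseteq> edges_on ?T"
    "?L (edge a b) = Poly_Mapping.lookup m (edge a b)" "?L (edge a c) = Poly_Mapping.lookup m (edge a c)"
    "?L (edge a d) = Poly_Mapping.lookup m (edge a d)" "?L (edge b c) = Poly_Mapping.lookup m (edge b c)"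
    "?L (edge b d) = Poly_Mapping.lookup m (edge b d)" "?L (edge c d) = Poly_Mapping.lookup m (edge c d)" for m
  proof (rule poly_mapping_eqI)
    fix e
    show "?L e = Poly_Mapping.lookup m e"
    proof (cases "e \<in> edges_on ?T")
      case True
      then have "e \<in> {edge a b, edge a c, edge a d, edge b c, edge b d, edge c d}"
        unfolding edges_on_def by (auto simp: edge_eq_iff)
      then show ?thesis using that by auto
    next
      case False
      then have "e \<notin> Poly_Mapping.keys p" "e \<notin> Poly_Mapping.keys m" using kp that(1) by auto
      then show ?thesis by (simp add: in_keys_iff)
    qed
  qed
  have lb: "Poly_Mapping.lookup (pairing a b c d) (edge a b) = 1" "Poly_Mapping.lookup (pairing a b c d) (edge a c) = 0"
    "Poly_Mapping.lookup (pairing a b c d) (edge a d) = 0" "Poly_Mapping.lookup (pairing a b c d) (edge b c) = 0"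
    "Poly_Mapping.lookup (pairing a b c d) (edge b d) = 0" "Poly_Mapping.lookup (pairing a b c d) (edge c d) = 1"
    using assms(1) by (simp_all add: pairing_def lookup_add lookup_single when_def edge_eq_iff)
  have lc: "Poly_Mapping.lookup (pairing a c b d) (edge a b) = 0" "Poly_Mapping.lookup (pairing a c b d) (edge a c) = 1"
    "Poly_Mapping.lookup (pairing a c b d) (edge a d) = 0" "Poly_Mapping.lookup (pairing a c b d) (edge b c) = 0"
    "Poly_Mapping.lookup (pairing a c b d) (edge b d) = 1" "Poly_Mapping.lookup (pairing a c b d) (edge c d) = 0"
    using assms(1) by (simp_all add: pairing_def lookup_add lookup_single when_def edge_eq_iff)
  have zero: "?L e = 0" if "Poly_Mapping.lookup (pairing a b c d) e = 0" "Poly_Mapping.lookup M e = 0" for e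
    using that by (intro sum_zero_lookup[OF assms(2)]) (simp add: lookup_add)
  have diag: "?L (edge a d) = 0" "?L (edge b c) = 0"
    using assms(3) lb lc by (auto intro!: zero)
  have deg: "?L (edge a b) + ?L (edge a c) = 1" "?L (edge a b) + ?L (edge b d) = 1" "?L (edge a c) + ?L (edge c d) = 1"
  proof -
    have "row_degree ?T a p = ?L (edge a b) + ?L (edge a c) + ?L (edge a d)"
      "row_degree ?T b p = ?L (edge b a) + ?L (edge b c) + ?L (edge b d)"
      "row_degree ?T c p = ?L (edge c a) + ?L (edge c b) + ?L (edge c d)"
      using assms(1) by (auto simp: row_degree_def insert_Diff_if)
    then show "?L (edge a b) + ?L (edge a c) = 1" "?L (edge a b) + ?L (edge b d) = 1" "?L (edge a c) + ?L (edge c d) = 1"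
      using assms(4)[of a] assms(4)[of b] assms(4)[of c] diag
      unfolding edge_commute[of b a] edge_commute[of c a] edge_commute[of c b] by auto
  qed
  show ?thesis
  proof (cases "?L (edge a c) = 0")
    case True
    have "p = pairing a b c d"
      by (rule eqI) (use keys_pairing[OF assms(1) refl] lb diag deg True in auto)
    then show ?thesis using assms(2) by simp
  next
    case False
    then have M': "M = pairing a c b d" using zero[of "edge a c"] assms(3) lb(2) by auto
    have "p = pairing a c b d"
      by (rule eqI) (use keys_pairing[of a c b d ?T] assms(1) lc diag deg False in auto)
    then show ?thesis using assms(2) M' by (simp add: add.commute[of "pairing a b c d"])
  qed
qed

section \<open>Factorizations over the complex numbers\<close>

text \<open>The equations say that \<open>(\<alpha> x + \<alpha> y) (\<beta> x + \<beta> y) = 0\<close>, and either factor vanishing forces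
  \<open>\<alpha> x = - \<alpha> y\<close>. Three nonzero elements cannot be pairwise opposite.\<close>

lemma square_of_pairings_contradiction:
  fixes \<alpha> \<beta> :: "'i \<Rightarrow> 'a::{idom, ring_char_0}"
  assumes "distinct [i, j, k]" "c \<noteq> 0"
    "\<And>x. x \<in> {i, j, k} \<Longrightarrow> \<alpha> x * \<beta> x = c"
    "\<And>x y. x \<in> {i, j, k} \<Longrightarrow> y \<in> {i, j, k} \<Longrightarrow> x \<noteq> y \<Longrightarrow> \<alpha> x * \<beta> y + \<alpha> y * \<beta> x = - 2 * c"
  shows False
proof -
  have neg: "\<alpha> x = - \<alpha> y" if xy: "x \<in> {i, j, k}" "y \<in> {i, j, k}" "x \<noteq> y" for x y
  proof -
    have "(\<alpha> x + \<alpha> y) * (\<beta> x + \<beta> y) = \<alpha> x * \<beta> x + \<alpha> y * \<beta> y + (\<alpha> x * \<beta> y + \<alpha> y * \<beta> x)"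
      by (simp add: algebra_simps)
    also have "\<dots> = 0" using assms(3)[OF xy(1)] assms(3)[OF xy(2)] assms(4)[OF xy] by simp
    finally consider "\<alpha> x + \<alpha> y = 0" | "\<beta> x + \<beta> y = 0" by auto
    then show ?thesis
    proof cases
      case 1
      then show ?thesis by (simp add: eq_neg_iff_add_eq_0)
    next
      case 2
      then have b: "\<beta> x = - \<beta> y" by (simp add: eq_neg_iff_add_eq_0)
      have "(\<alpha> x + \<alpha> y) * \<beta> y = \<alpha> y * \<beta> y - \<alpha> x * \<beta> x" unfolding b by (simp add: algebra_simps)
      then have "(\<alpha> x + \<alpha> y) * \<beta> y = 0" using assms(3)[OF xy(1)] assms(3)[OF xy(2)] by simp
      moreover have "\<beta> y \<noteq> 0" using assms(2) assms(3)[OF xy(2)] by auto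
      ultimately show ?thesis by (simp add: eq_neg_iff_add_eq_0)
    qed
  qed
  have "\<alpha> i = - \<alpha> j" "\<alpha> j = - \<alpha> k" "\<alpha> i = - \<alpha> k" using assms(1) by (auto intro!: neg)
  then have "\<alpha> k + \<alpha> k = 0" by (metis add.right_inverse minus_minus)
  then have "2 * \<alpha> k = 0" by (simp only: mult_2)
  then have "\<alpha> k = 0" by simp
  then show False using assms(2) assms(3)[of k] by simp
qed

lemma distinct_decompositions_sum:
  assumes "P \<noteq> (Q::'a::comm_monoid_add)" "P + Q = (m::'a)"
    "\<And>a b. a \<in> Poly_Mapping.keys p \<Longrightarrow> b \<in> Poly_Mapping.keys q \<Longrightarrow> a + b = m \<Longrightarrow> (a = P \<and> b = Q) \<or> (a = Q \<and> b = P)"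
  shows "Poly_Mapping.lookup (p * q) m = (Poly_Mapping.lookup p P * Poly_Mapping.lookup q Q + Poly_Mapping.lookup p Q * Poly_Mapping.lookup q P :: 'b::comm_semiring_1)"
proof -
  have "Poly_Mapping.lookup (p * q) m = (\<Sum>(a, b)\<in>{(P, Q), (Q, P)}. Poly_Mapping.lookup p a * Poly_Mapping.lookup q b)"
  proof (rule lookup_mult_decompositions)
    show "a + b = m" if "(a, b) \<in> {(P, Q), (Q, P)}" for a b
      using that assms(2) by (auto simp: add.commute)
    show "(a, b) \<in> {(P, Q), (Q, P)}" if "a \<in> Poly_Mapping.keys p" "b \<in> Poly_Mapping.keys q" "a + b = m" for a b
      using assms(3)[OF that] by auto
  qed simp
  then show ?thesis using assms(1) by simp
qed

text \<open>The scalar \<open>u\<close> covers both parities at once: it is 1 for even \<open>n\<close> and 1/2 for odd \<open>n\<close>.\<close>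

locale scaled_det_factorization =
  fixes n :: nat and A B :: cpolynomial and u :: complex
  assumes n: "4 \<le> n" and u: "u \<noteq> 0"
    and lookup_AB: "\<And>m. Poly_Mapping.lookup (A * B) m = u * of_int (det_coeff {..<n} m)"
    and vars_A: "\<And>m. m \<in> Poly_Mapping.keys A \<Longrightarrow> Poly_Mapping.keys m \<subseteq> edges_on {..<n}"
    and vars_B: "\<And>m. m \<in> Poly_Mapping.keys B \<Longrightarrow> Poly_Mapping.keys m \<subseteq> edges_on {..<n}"
begin

abbreviation V :: "nat set" where "V \<equiv> {..<n}"

lemma keys_AB: "m \<in> Poly_Mapping.keys (A * B) \<longleftrightarrow> det_coeff V m \<noteq> 0"
  using u by (simp add: in_keys_iff lookup_AB)

lemma nonzero: "A \<noteq> 0" "B \<noteq> 0"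
proof -
  have "finite V" "card V \<noteq> 1" using n by auto
  then obtain m where "\<bar>det_coeff V m\<bar> = (if even (card V) then 1 else 2)"
    by (rule det_coeff_primitive)
  then have "m \<in> Poly_Mapping.keys (A * B)" unfolding keys_AB by (auto split: if_splits)
  then have "A * B \<noteq> 0" by auto
  then show "A \<noteq> 0" "B \<noteq> 0" by auto
qed

lemma row_degrees:
  assumes "i \<in> V"
  obtains a b where "a + b = 2" "\<And>p. p \<in> Poly_Mapping.keys A \<Longrightarrow> row_degree V i p = a"
    "\<And>q. q \<in> Poly_Mapping.keys B \<Longrightarrow> row_degree V i q = b"
proof (rule factors_homogeneous[OF nonzero, of "row_degree V i" 2])
  fix m assume "m \<in> Poly_Mapping.keys (A * B)"
  then obtain \<sigma> where "\<sigma> \<in> derangements V" "m = cycle_monom V \<sigma>"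
    unfolding keys_AB by (rule det_coeff_nonzeroD)
  then show "row_degree V i m = 2" using assms by (simp add: row_degree_cycle_monom)
qed (use that in \<open>auto simp: row_degree_add\<close>)

lemma split_key:
  assumes "det_coeff V m \<noteq> 0"
  obtains p q where "p \<in> Poly_Mapping.keys A" "q \<in> Poly_Mapping.keys B" "p + q = m"
  using assms Poly_Mapping.keys_mult[of A B] unfolding keys_AB[symmetric] by blast

text \<open>In a monomial of the determinant with the factor \<open>x\<^sub>i\<^sub>j\<^sup>2\<close> no other variable involves the rows \<open>i\<close> and
  \<open>j\<close>. Such a monomial exists because the \<open>n - 2 \<ge> 2\<close> other rows have a nonzero minor.\<close>

lemma row_degree_eq:
  assumes "i \<in> V" "j \<in> V" "i \<noteq> j"
  obtains p where "p \<in> Poly_Mapping.keys A" "row_degree V i p = row_degree V j p"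
proof -
  let ?R = "V - {i, j}"
  have V: "insert i (insert j ?R) = V" using assms by auto
  have "card ?R = n - 2" using assms by (simp add: card_Diff_subset)
  then have "finite ?R" "card ?R \<noteq> 1" using n by auto
  then obtain M where "\<bar>det_coeff ?R M\<bar> = (if even (card ?R) then 1 else 2)"
    by (rule det_coeff_primitive)
  then have M: "det_coeff ?R M \<noteq> 0" by (auto split: if_splits)
  note kM = keys_of_det_coeff[OF M]
  let ?M = "M + Poly_Mapping.single (edge i j) 2"
  have "det_coeff V ?M = - det_coeff ?R M"
    using det_coeff_double[of ?R i j M] kM assms V by auto
  then have "det_coeff V ?M \<noteq> 0" using M by simp
  then obtain p q where pq: "p \<in> Poly_Mapping.keys A" "q \<in> Poly_Mapping.keys B" "p + q = ?M"
    by (rule split_key)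
  have z: "Poly_Mapping.lookup p (edge k l) = 0" if "k \<in> {i, j}" "l \<notin> {i, j}" for k l
  proof (rule sum_zero_lookup[OF pq(3)])
    have "Poly_Mapping.lookup M (edge k l) = 0" by (rule lookup_edge_outside[OF kM]) (use that in auto)
    then show "Poly_Mapping.lookup ?M (edge k l) = 0"
      using that by (auto simp: lookup_add lookup_single when_def edge_eq_iff)
  qed
  have "row_degree V i p = Poly_Mapping.lookup p (edge i j)"
    using assms by (intro row_degree_one_neighbour z) auto
  moreover have "row_degree V j p = Poly_Mapping.lookup p (edge j i)"
    using assms by (intro row_degree_one_neighbour z) auto
  ultimately show ?thesis using that[OF pq(1)] by (simp add: edge_commute)
qed

lemma uniform_row_degree:
  obtains a b where "a + b = 2"
    "\<And>i p. i \<in> V \<Longrightarrow> p \<in> Poly_Mapping.keys A \<Longrightarrow> row_degree V i p = a"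
    "\<And>i q. i \<in> V \<Longrightarrow> q \<in> Poly_Mapping.keys B \<Longrightarrow> row_degree V i q = b"
proof -
  have "0 \<in> V" using n by auto
  then obtain a b where ab: "a + b = 2" "\<And>p. p \<in> Poly_Mapping.keys A \<Longrightarrow> row_degree V 0 p = a"
    "\<And>q. q \<in> Poly_Mapping.keys B \<Longrightarrow> row_degree V 0 q = b"
    by (rule row_degrees) blast
  have "(\<forall>p\<in>Poly_Mapping.keys A. row_degree V i p = a) \<and> (\<forall>q\<in>Poly_Mapping.keys B. row_degree V i q = b)"
    if i: "i \<in> V" for i
  proof (cases "i = 0")
    case False
    obtain a' b' where ab': "a' + b' = 2" "\<And>p. p \<in> Poly_Mapping.keys A \<Longrightarrow> row_degree V i p = a'"
      "\<And>q. q \<in> Poly_Mapping.keys B \<Longrightarrow> row_degree V i q = b'"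
      using i by (rule row_degrees) blast
    obtain p where "p \<in> Poly_Mapping.keys A" "row_degree V i p = row_degree V 0 p"
      using i \<open>0 \<in> V\<close> False by (rule row_degree_eq)
    then have "a' = a" using ab ab' by auto
    then show ?thesis using ab ab' by auto
  qed (use ab in auto)
  then show ?thesis using that[OF ab(1)] by blast
qed

lemma matching_summand:
  assumes deg: "\<And>i p. i \<in> V \<Longrightarrow> p \<in> Poly_Mapping.keys A \<Longrightarrow> row_degree V i p = 1"
    and r: "perfect_matching S r" "S = V - T" "T \<subseteq> V" and m: "Poly_Mapping.keys m \<subseteq> edges_on T"
    and pq: "p \<in> Poly_Mapping.keys A" "p + q = m + (r + r)"
  obtains p' q' where "p = p' + r" "q = q' + r" "p' + q' = m"
    "Poly_Mapping.keys p' \<subseteq> edges_on T" "\<And>v. v \<in> T \<Longrightarrow> row_degree T v p' = 1"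
proof -
  have "\<exists>p' q'. p = p' + r \<and> q = q' + r \<and> p' + q' = m"
    using deg pq(1) r(2,3) by (intro matching_split[OF r(1) _ _ _ m pq(2), of V]) auto
  then obtain p' q' where p': "p = p' + r" "q = q' + r" "p' + q' = m" by blast
  have k: "Poly_Mapping.keys p' \<subseteq> edges_on T" using keys_summand(1)[OF p'(3)] m by auto
  have "row_degree T v p' = 1" if v: "v \<in> T" for v
  proof -
    have "row_degree V v r = 0" using row_degree_outside[OF keys_matching[OF r(1)], of v V] v r(2) by auto
    moreover have "row_degree V v p = 1" using v r(3) deg pq(1) by auto
    ultimately have "row_degree V v p' = 1" by (simp add: p'(1) row_degree_add)
    then show ?thesis using row_degree_subset[OF _ r(3) k, of v] by simp
  qed
  then show ?thesis using that p' k by blast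
qed

text \<open>The three vertex degrees of a triangle add up to an even number, so they cannot all be 1.\<close>

lemma no_linear_factor_odd:
  assumes "odd n" and deg: "\<And>i p. i \<in> V \<Longrightarrow> p \<in> Poly_Mapping.keys A \<Longrightarrow> row_degree V i p = 1"
  shows False
proof -
  let ?T = "{0, 1, 2 :: nat}"
  let ?m = "Poly_Mapping.single (edge 0 1) 1 + Poly_Mapping.single (edge 1 2) 1 +
    Poly_Mapping.single (edge 2 0) (1::nat)"
  have T: "?T \<subseteq> V" using n by auto
  have "card (V - ?T) = n - 3" using T by (subst card_Diff_subset) auto
  then have "even (card (V - ?T))" using assms(1) n by simp
  then obtain r where r: "perfect_matching (V - ?T) r" using matching_exists[of "V - ?T"] by auto
  from matching_det_coeff[OF r] obtain s :: int where s: "s \<in> {1, -1}"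
    "\<And>T' m. finite T' \<Longrightarrow> T' \<inter> (V - ?T) = {} \<Longrightarrow> Poly_Mapping.keys m \<subseteq> edges_on T' \<Longrightarrow>
       det_coeff (T' \<union> (V - ?T)) (m + (r + r)) = s * det_coeff T' m" by blast
  have tri: "det_coeff ?T ?m = 2" by (rule det_coeff_triangle) simp
  then have k: "Poly_Mapping.keys ?m \<subseteq> edges_on ?T" by (intro keys_of_det_coeff) linarith
  have "?T \<union> (V - ?T) = V" using T by blast
  then have "det_coeff V (?m + (r + r)) = s * 2" using s(2)[of ?T ?m] k tri by (metis Diff_disjoint finite.emptyI finite_insert)
  then have "det_coeff V (?m + (r + r)) \<noteq> 0" using s(1) by auto
  then obtain p q where pq: "p \<in> Poly_Mapping.keys A" "q \<in> Poly_Mapping.keys B" "p + q = ?m + (r + r)"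
    by (rule split_key)
  obtain p' where p': "\<And>v. v \<in> ?T \<Longrightarrow> row_degree ?T v p' = 1"
    using matching_summand[OF deg r refl T k pq(1,3)] by metis
  let ?L = "Poly_Mapping.lookup p'"
  have "row_degree ?T 0 p' = ?L (edge 0 1) + ?L (edge 0 2)"
    "row_degree ?T 1 p' = ?L (edge 0 1) + ?L (edge 1 2)"
    "row_degree ?T 2 p' = ?L (edge 0 2) + ?L (edge 1 2)"
    unfolding row_degree_def edge_commute[of 0 1] edge_commute[of 0 2] edge_commute[of 1 2]
    by (simp_all add: insert_Diff_if edge_commute)
  then have "?L (edge 0 1) + ?L (edge 0 2) = 1" "?L (edge 0 1) + ?L (edge 1 2) = 1" "?L (edge 0 2) + ?L (edge 1 2) = 1"
    using p'[of 0] p'[of 1] p'[of 2] by auto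
  then show False by presburger
qed

text \<open>All \<open>M\<^sub>i M\<^sub>j r\<^sup>2\<close> decompose in the obvious ways only, so their coefficients in \<open>A B\<close> involve just the
  six numbers \<open>\<alpha>\<^sub>i, \<beta>\<^sub>i\<close>.\<close>

lemma no_linear_factor_even:
  assumes "even n" and deg: "\<And>i p. i \<in> V \<Longrightarrow> p \<in> Poly_Mapping.keys A \<Longrightarrow> row_degree V i p = 1"
  shows False
proof -
  let ?T = "{0, 1, 2, 3 :: nat}"
  have T: "?T \<subseteq> V" using n by auto
  have "card (V - ?T) = n - 4" using T by (subst card_Diff_subset) auto
  then have "even (card (V - ?T))" using assms(1) n by simp
  then obtain r where r: "perfect_matching (V - ?T) r" using matching_exists[of "V - ?T"] by auto
  from matching_det_coeff[OF r] obtain s :: int where s: "s \<in> {1, -1}"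
    "\<And>T' m. finite T' \<Longrightarrow> T' \<inter> (V - ?T) = {} \<Longrightarrow> Poly_Mapping.keys m \<subseteq> edges_on T' \<Longrightarrow>
       det_coeff (T' \<union> (V - ?T)) (m + (r + r)) = s * det_coeff T' m" by blast
  have TV: "?T \<union> (V - ?T) = V" using T by blast
  have dc: "det_coeff V (m + (r + r)) = s * det_coeff ?T m" if "det_coeff ?T m \<noteq> 0" for m
    using s(2)[of ?T m] keys_of_det_coeff[OF that] TV by (metis Diff_disjoint finite.emptyI finite_insert)
  define \<alpha> where "\<alpha> m = Poly_Mapping.lookup A (m + r)" for m
  define \<beta> where "\<beta> m = Poly_Mapping.lookup B (m + r)" for m
  have prods: "\<alpha> (pairing a b c d) * \<beta> (pairing a b c d) = u * of_int s"
    "\<alpha> (pairing a b c d) * \<beta> (pairing a c b d) + \<alpha> (pairing a c b d) * \<beta> (pairing a b c d) = - 2 * (u * of_int s)"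
    if abcd: "distinct [a, b, c, d]" "{a, b, c, d} = ?T" for a b c d
  proof -
    let ?P = "pairing a b c d" and ?Q = "pairing a c b d"
    have d1: "det_coeff ?T (?P + ?P) = 1" using det_coeff_pairing_square[OF abcd(1)] unfolding abcd(2) .
    have d2: "det_coeff ?T (?P + ?Q) = - 2" using det_coeff_pairing_product[OF abcd(1)] unfolding abcd(2) .
    have "Poly_Mapping.lookup ?P (edge a b) = 1" "Poly_Mapping.lookup ?Q (edge a b) = 0"
      using abcd(1) by (simp_all add: pairing_def lookup_add lookup_single when_def edge_eq_iff)
    then have PQ: "?P \<noteq> ?Q" by force
    have dec: "(p = ?P + r \<and> q = M + r) \<or> (p = M + r \<and> q = ?P + r)"
      if M: "M = ?P \<or> M = ?Q" and p: "p \<in> Poly_Mapping.keys A" and pq: "p + q = (?P + r) + (M + r)" for p q M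
    proof -
      have "det_coeff ?T (?P + M) \<noteq> 0" using M d1 d2 by auto
      then have k: "Poly_Mapping.keys (?P + M) \<subseteq> edges_on ?T" by (rule keys_of_det_coeff)
      have pq': "p + q = (?P + M) + (r + r)" unfolding pq by (simp only: ac_simps)
      obtain p' q' where p': "p = p' + r" "q = q' + r" "p' + q' = ?P + M"
        "\<And>v. v \<in> ?T \<Longrightarrow> row_degree ?T v p' = 1"
        using matching_summand[OF deg r refl T k p pq'] by metis
      have "(p' = ?P \<and> q' = M) \<or> (p' = M \<and> q' = ?P)"
        by (rule pairing_decompositions[OF abcd(1) p'(3) M]) (use p'(4) in \<open>simp add: abcd(2)\<close>)
      then show ?thesis using p' by auto
    qed
    have "Poly_Mapping.lookup (A * B) ((?P + r) + (?P + r)) = (\<Sum>(a, b)\<in>{(?P + r, ?P + r)}. Poly_Mapping.lookup A a * Poly_Mapping.lookup B b)"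
      by (rule lookup_mult_decompositions) (use dec in auto)
    also have "\<dots> = \<alpha> ?P * \<beta> ?P" by (simp add: \<alpha>_def \<beta>_def)
    also have "(?P + r) + (?P + r) = (?P + ?P) + (r + r)" by (simp only: ac_simps)
    finally show "\<alpha> ?P * \<beta> ?P = u * of_int s" using d1 dc[of "?P + ?P"] by (simp add: lookup_AB)
    have "?P + r \<noteq> ?Q + r" using PQ by simp
    then have "Poly_Mapping.lookup (A * B) ((?P + r) + (?Q + r)) = \<alpha> ?P * \<beta> ?Q + \<alpha> ?Q * \<beta> ?P"
      unfolding \<alpha>_def \<beta>_def by (rule distinct_decompositions_sum[OF _ refl]) (rule dec; simp)
    also have "(?P + r) + (?Q + r) = (?P + ?Q) + (r + r)" by (simp only: ac_simps)
    finally have "\<alpha> ?P * \<beta> ?Q + \<alpha> ?Q * \<beta> ?P = u * of_int (det_coeff V ((?P + ?Q) + (r + r)))"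
      by (simp only: lookup_AB)
    also have "det_coeff V ((?P + ?Q) + (r + r)) = s * - 2" using d2 dc[of "?P + ?Q"] by simp
    finally show "\<alpha> ?P * \<beta> ?Q + \<alpha> ?Q * \<beta> ?P = - 2 * (u * of_int s)" by simp
  qed
  let ?M1 = "pairing 0 1 2 3" and ?M2 = "pairing 0 2 1 3" and ?M3 = "pairing 0 3 1 2"
  have sw: "pairing a b c d = pairing a b d c" for a b c d by (simp add: pairing_def edge_commute)
  have sets: "{0, 2, 1, 3} = ?T" "{0, 3, 1, 2} = ?T" "{0, 1, 3, 2} = ?T" "{0, 2, 3, 1} = ?T" by auto
  \<comment> \<open>Three labellings of the four vertices cover the three pairs of pairings.\<close>
  note e = prods[of 0 1 2 3] prods[of 0 2 1 3] prods[of 0 3 1 2] prods(2)[of 0 1 3 2] prods(2)[of 0 2 3 1]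
  have c: "u * of_int s \<noteq> 0" using u s(1) by auto
  have sq: "\<alpha> ?M1 * \<beta> ?M1 = u * of_int s" "\<alpha> ?M2 * \<beta> ?M2 = u * of_int s" "\<alpha> ?M3 * \<beta> ?M3 = u * of_int s"
    using e sets by simp_all
  have cr: "\<alpha> ?M1 * \<beta> ?M2 + \<alpha> ?M2 * \<beta> ?M1 = - 2 * (u * of_int s)"
    "\<alpha> ?M1 * \<beta> ?M3 + \<alpha> ?M3 * \<beta> ?M1 = - 2 * (u * of_int s)"
    "\<alpha> ?M2 * \<beta> ?M3 + \<alpha> ?M3 * \<beta> ?M2 = - 2 * (u * of_int s)"
    using e sets sw[of 0 1 3 2] sw[of 0 2 3 1] sw[of 0 3 2 1] by simp_all
  have "distinct [?M1, ?M2, ?M3]"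
  proof -
    have "Poly_Mapping.lookup ?M1 (edge 0 1) = 1" "Poly_Mapping.lookup ?M2 (edge 0 1) = 0"
      "Poly_Mapping.lookup ?M3 (edge 0 1) = 0" "Poly_Mapping.lookup ?M2 (edge 0 2) = 1" "Poly_Mapping.lookup ?M3 (edge 0 2) = 0"
      by (simp_all add: pairing_def lookup_add lookup_single when_def edge_eq_iff)
    then show ?thesis by (metis distinct_length_2_or_more distinct_singleton zero_neq_one)
  qed
  then show False
  proof (rule square_of_pairings_contradiction[where \<alpha> = \<alpha> and \<beta> = \<beta>, OF _ c])
    fix x assume "x \<in> {?M1, ?M2, ?M3}"
    then show "\<alpha> x * \<beta> x = u * of_int s" using sq by blast
  next
    fix x y assume "x \<in> {?M1, ?M2, ?M3}" "y \<in> {?M1, ?M2, ?M3}" "x \<noteq> y"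
    then show "\<alpha> x * \<beta> y + \<alpha> y * \<beta> x = - 2 * (u * of_int s)"
      using cr by (elim insertE emptyE) (simp_all add: add.commute)
  qed
qed

lemma constant_if_row_degrees_zero:
  assumes "\<And>m. m \<in> Poly_Mapping.keys C \<Longrightarrow> Poly_Mapping.keys m \<subseteq> edges_on V"
    "\<And>i p. i \<in> V \<Longrightarrow> p \<in> Poly_Mapping.keys C \<Longrightarrow> row_degree V i p = 0"
  shows "C = Const (Poly_Mapping.lookup C 0)"
proof -
  have "m = 0" if "m \<in> Poly_Mapping.keys C" for m
    using assms that by (intro row_degrees_zeroD[of V]) auto
  then show ?thesis unfolding Const_def
    by (intro poly_mapping_eqI) (auto simp: lookup_single when_def in_keys_iff)
qed

theorem constant_factor:
  "A = Const (Poly_Mapping.lookup A 0) \<or> B = Const (Poly_Mapping.lookup B 0)"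
proof -
  obtain a b where ab: "a + b = 2"
    "\<And>i p. i \<in> V \<Longrightarrow> p \<in> Poly_Mapping.keys A \<Longrightarrow> row_degree V i p = a"
    "\<And>i q. i \<in> V \<Longrightarrow> q \<in> Poly_Mapping.keys B \<Longrightarrow> row_degree V i q = b"
    by (rule uniform_row_degree) blast
  consider "a = 0" | "b = 0" | "a = 1" using ab(1) by linarith
  then show ?thesis
  proof cases
    case 1
    then show ?thesis using constant_if_row_degrees_zero[OF vars_A] ab(2) by blast
  next
    case 2
    then show ?thesis using constant_if_row_degrees_zero[OF vars_B] ab(3) by blast
  next
    case 3
    then show ?thesis using no_linear_factor_odd no_linear_factor_even ab(2) by blast
  qed
qed

end

section \<open>Irreducibility over the algebraic integers\<close>

lemma lookup_Const_mult: "Poly_Mapping.lookup (Const c * p) m = c * Poly_Mapping.lookup p m"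
  unfolding Const_def mult_map_scale_conv_mult[symmetric] by (simp add: map.rep_eq when_def)

lemma lookup_K:
  "Poly_Mapping.lookup (K n) m = (if even n then 1 else 1 / 2) * of_int (det_coeff {..<n} m)"
  by (simp add: K_def lookup_det_X lookup_Const_mult)

lemma lookup_K_int: "\<exists>k::int. Poly_Mapping.lookup (K n) m = of_int k"
proof (cases "even n")
  case False
  then have "even (det_coeff {..<n} m)" by (intro even_det_coeff) auto
  then obtain k where "det_coeff {..<n} m = 2 * k" by (rule evenE)
  then show ?thesis using False by (simp add: lookup_K)
qed (simp add: lookup_K)

lemma K_in_carrier: "K n \<in> carrier (alg_int_poly_ring n)"
proof -
  have "algebraic_int (Poly_Mapping.lookup (K n) m)" for m
    using lookup_K_int[of n m] by auto
  moreover have "Poly_Mapping.keys m \<subseteq> var_indices n" if "m \<in> Poly_Mapping.keys (K n)" for m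
    using that unfolding edges_on_lessThan[symmetric] by (intro keys_of_det_coeff) (auto simp: in_keys_iff lookup_K)
  ultimately show ?thesis by (simp add: alg_int_poly_ring_def)
qed

lemma K_unimodular_coeff:
  assumes "n \<noteq> 1"
  obtains m where "Poly_Mapping.lookup (K n) m \<in> {1, -1}"
proof -
  obtain m where "\<bar>det_coeff {..<n} m\<bar> = (if even n then 1 else 2)"
    using det_coeff_primitive[of "{..<n}"] assms by auto
  then have "det_coeff {..<n} m \<in> (if even n then {1, -1} else {2, -2})" by (auto split: if_splits)
  then have "Poly_Mapping.lookup (K n) m \<in> {1, -1}" by (auto simp: lookup_K split: if_splits)
  then show ?thesis by (rule that)
qed

lemma Const_in_carrier: "Const c \<in> carrier (alg_int_poly_ring n) \<longleftrightarrow> algebraic_int c"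
  by (auto simp: alg_int_poly_ring_def Const_def lookup_single when_def dest: spec[of _ 0])

lemma Const_one: "Const 1 = 1"
  by (simp add: Const_def)

lemma Const_mult: "Const c * Const d = Const (c * d)"
  by (simp add: Const_def mult_single)

text \<open>The constant divides the coefficient \<open>\<plusminus>1\<close> of \<open>K n\<close>, and the cofactor is an algebraic integer.\<close>

lemma constant_factor_invertible:
  assumes "n \<noteq> 1" "K n = Const c * q" "q \<in> carrier (alg_int_poly_ring n)"
  obtains d where "algebraic_int d" "c * d = 1"
proof -
  obtain m where m: "Poly_Mapping.lookup (K n) m \<in> {1, -1}" using assms(1) by (rule K_unimodular_coeff)
  let ?x = "Poly_Mapping.lookup q m"
  have x: "algebraic_int ?x" using assms(3) by (simp add: alg_int_poly_ring_def)
  from m consider "c * ?x = 1" | "c * (- ?x) = 1" unfolding assms(2) lookup_Const_mult by auto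
  then show ?thesis by cases (use that[of ?x] that[of "- ?x"] x in auto)
qed

text \<open>Row degrees are additive, and every monomial of \<open>K n\<close> has degree 2 in the first row.\<close>

lemma K_not_unit:
  assumes "n \<ge> 1"
  shows "K n \<notin> Units (alg_int_poly_ring n)"
proof
  assume "K n \<in> Units (alg_int_poly_ring n)"
  then obtain y where "K n * y = 1" by (auto simp: Units_def alg_int_poly_ring_def)
  then have "0 \<in> Poly_Mapping.keys (K n * y)" by simp
  then obtain p q where pq: "p \<in> Poly_Mapping.keys (K n)" "p + q = 0"
    using Poly_Mapping.keys_mult[of "K n" y] by auto
  have "p = 0" by (intro poly_mapping_eqI) (simp add: sum_zero_lookup[OF pq(2)])
  from pq(1) have "det_coeff {..<n} p \<noteq> 0" by (auto simp: in_keys_iff lookup_K)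
  then obtain \<sigma> where "\<sigma> \<in> derangements {..<n}" "p = cycle_monom {..<n} \<sigma>" by (rule det_coeff_nonzeroD)
  then have "row_degree {..<n} 0 p = 2" using assms by (simp add: row_degree_cycle_monom)
  then show False using \<open>p = 0\<close> by simp
qed

theorem mainTheorem7:
  fixes n :: nat
  assumes "n \<ge> 4"
  shows "K n \<in> carrier (alg_int_poly_ring n) \<and>
         ring_irreducible\<^bsub>alg_int_poly_ring n\<^esub> (K n)"
proof -
  let ?R = "alg_int_poly_ring n"
  have ops: "mult ?R = (*)" "one ?R = 1" "zero ?R = 0" by (simp_all add: alg_int_poly_ring_def)
  have "K n \<noteq> 0"
  proof -
    have "n \<noteq> 1" using assms by simp
    then obtain m where "Poly_Mapping.lookup (K n) m \<in> {1, -1}" by (rule K_unimodular_coeff)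
    then show ?thesis by auto
  qed
  moreover have "b \<in> Units ?R" if b: "b \<in> carrier ?R" and pf: "properfactor ?R b (K n)" for b
  proof -
    from pf obtain c where c: "c \<in> carrier ?R" "K n = b * c"
      and ndvd: "\<not> K n divides\<^bsub>?R\<^esub> b" by (auto simp: properfactor_def factor_def ops)
    interpret scaled_det_factorization n b c "if even n then 1 else 1 / 2"
      using assms b c(1)
      by unfold_locales (auto simp: c(2)[symmetric] lookup_K edges_on_lessThan alg_int_poly_ring_def)
    from constant_factor show ?thesis
    proof
      assume bc: "b = Const (Poly_Mapping.lookup b 0)" (is "_ = Const ?b")
      then obtain d where d: "algebraic_int d" "?b * d = 1"
        using constant_factor_invertible[of n ?b c] assms c by auto
      have "Const d \<in> carrier ?R" using d(1) by (simp add: Const_in_carrier)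
      moreover have "b * Const d = 1" by (subst bc) (simp only: Const_mult d(2) Const_one)
      ultimately show ?thesis using b by (auto simp: Units_def ops mult.commute)
    next
      assume cc: "c = Const (Poly_Mapping.lookup c 0)" (is "_ = Const ?c")
      then obtain d where d: "algebraic_int d" "?c * d = 1"
        using constant_factor_invertible[of n ?c b] assms b c(2) by (auto simp: mult.commute)
      have "Const d \<in> carrier ?R" using d(1) by (simp add: Const_in_carrier)
      moreover have "c * Const d = 1" by (subst cc) (simp only: Const_mult d(2) Const_one)
      then have "b = K n * Const d" unfolding c(2) by (simp add: mult.assoc)
      ultimately have "K n divides\<^bsub>?R\<^esub> b" by (auto simp: factor_def ops)
      with ndvd show ?thesis by contradiction
    qed
  qed
  ultimately show ?thesis
    using K_in_carrier K_not_unit[of n] assms by (auto simp: ring_irreducible_def Divisibility.irreducible_def ops)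
qed

end
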